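(* Let $H_1,\dots,H_n$ be fixed Hermitian matrices of common dimension $d \ge 8$, let $\gamma_1,\dots,\gamma_n$ be independent standard normal random variables, and let $X := \sum_{i=1}^n \gamma_i H_i$. Define $$\sigma(X) := \left\| \sum_{i=1}^n H_i^2 \right\|^{1/2} \quad\text{and}\quad w(X) := \max_{Q_1,Q_2,Q_3} \left\| \sum_{i,j=1}^n H_i Q_1 H_j Q_2 H_i Q_3 H_j \right\|^{1/4},$$ where the maximum ranges over all triples $(Q_1,Q_2,Q_3)$ of $d \times d$ unitary matrices. Then $$\mathbb{E} \|X\| \;\le\; 3\,\sigma(X)\, (2 \mathrm{e} \log d)^{1/4} \;+\; w(X)\, \sqrt{2 \mathrm{e} \log d}.$$
   Context: Matrices have complex entries. The symbol $\|\cdot\|$ denotes the spectral norm ($\ell_2$ operator norm), $\log$ is the natural logarithm, and $\mathrm{e}$ is its base. *)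

theory Defs
  imports "HOL-Probability.Probability"
begin

definition conj_transpose :: "complex^'n^'m \<Rightarrow> complex^'m^'n" where
  "conj_transpose A = (\<chi> i j. cnj (A $ j $ i))"

definition hermitian_matrix :: "complex^'n^'n \<Rightarrow> bool" where
  "hermitian_matrix A \<longleftrightarrow> conj_transpose A = A"

definition unitary_matrix :: "complex^'n^'n \<Rightarrow> bool" where
  "unitary_matrix Q \<longleftrightarrow> conj_transpose Q ** Q = mat 1 \<and> Q ** conj_transpose Q = mat 1"

(* The norm of the type complex^'n^'n itself is the Frobenius norm, so the operator norm
   with respect to the Euclidean norm of complex^'n is used explicitly. *)
definition spectral_norm :: "complex^'n^'n \<Rightarrow> real" where
  "spectral_norm A = onorm ((*v) A)"

definition gauss_series :: "nat \<Rightarrow> (nat \<Rightarrow> complex^'d^'d) \<Rightarrow> (nat \<Rightarrow> 'a \<Rightarrow> real) \<Rightarrow> 'a \<Rightarrow> complex^'d^'d" where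
  "gauss_series n H \<gamma> \<omega> = (\<Sum>i=1..n. \<gamma> i \<omega> *\<^sub>R H i)"

(* sigma(X) and w(X) depend on X only through its coefficient matrices. *)
definition matrix_sigma :: "nat \<Rightarrow> (nat \<Rightarrow> complex^'d^'d) \<Rightarrow> real" where
  "matrix_sigma n H = sqrt (spectral_norm (\<Sum>i=1..n. H i ** H i))"

definition alignment_term ::
  "nat \<Rightarrow> (nat \<Rightarrow> complex^'d^'d) \<Rightarrow> (complex^'d^'d) \<times> (complex^'d^'d) \<times> (complex^'d^'d) \<Rightarrow> real" where
  "alignment_term n H = (\<lambda>(Q1, Q2, Q3).
     root 4 (spectral_norm (\<Sum>i=1..n. \<Sum>j=1..n. H i ** Q1 ** H j ** Q2 ** H i ** Q3 ** H j)))"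

(* The supremum is a maximum: see matrix_w_max below. *)
definition matrix_w :: "nat \<Rightarrow> (nat \<Rightarrow> complex^'d^'d) \<Rightarrow> real" where
  "matrix_w n H =
     (SUP Q \<in> Collect unitary_matrix \<times> Collect unitary_matrix \<times> Collect unitary_matrix.
        alignment_term n H Q)"

lemma continuous_on_matrix_mult [continuous_intros]:
  fixes f :: "'a::topological_space \<Rightarrow> complex^'n^'m" and g :: "'a \<Rightarrow> complex^'k^'n"
  assumes "continuous_on S f" "continuous_on S g"
  shows "continuous_on S (\<lambda>x. f x ** g x)"
  unfolding matrix_matrix_mult_def by (intro continuous_intros assms)

lemma continuous_on_conj_transpose [continuous_intros]:
  fixes f :: "'a::topological_space \<Rightarrow> complex^'n^'m"
  assumes "continuous_on S f"
  shows "continuous_on S (\<lambda>x. conj_transpose (f x))"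
  unfolding conj_transpose_def by (intro continuous_intros assms)

lemma continuous_on_spectral_norm [continuous_intros]:
  fixes f :: "'a::topological_space \<Rightarrow> complex^'n^'n"
  assumes "continuous_on S f"
  shows "continuous_on S (\<lambda>x. spectral_norm (f x))"
proof -
  have bl: "bounded_linear ((*v) A)" for A :: "complex^'n^'n"
    by simp
  have eq: "spectral_norm A = norm (Blinfun ((*v) A))" for A :: "complex^'n^'n"
    by (simp add: spectral_norm_def norm_blinfun.rep_eq bounded_linear_Blinfun_apply bl)
  have scal: "(r *\<^sub>R A) *v x = r *\<^sub>R (A *v x)" for r and A :: "complex^'n^'n" and x
    by (simp add: matrix_vector_mult_def vec_eq_iff scaleR_sum_right)
  have "linear (\<lambda>A :: complex^'n^'n. Blinfun ((*v) A))"
    by (rule linearI; rule blinfun_eqI)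
       (simp_all add: bounded_linear_Blinfun_apply bl plus_blinfun.rep_eq scaleR_blinfun.rep_eq
          matrix_vector_mult_add_rdistrib scal)
  then have "continuous_on UNIV (\<lambda>A :: complex^'n^'n. Blinfun ((*v) A))"
    by (simp add: linear_continuous_on linear_conv_bounded_linear)
  then have "continuous_on UNIV (\<lambda>A :: complex^'n^'n. spectral_norm A)"
    unfolding eq by (intro continuous_intros)
  from continuous_on_compose2[OF this assms] show ?thesis by simp
qed

lemma compact_unitary: "compact (Collect unitary_matrix :: (complex^'n^'n) set)"
proof -
  have "closed {Q :: complex^'n^'n. conj_transpose Q ** Q = mat 1}"
    "closed {Q :: complex^'n^'n. Q ** conj_transpose Q = mat 1}"
    by (intro closed_Collect_eq continuous_intros)+
  then have "closed (Collect unitary_matrix :: (complex^'n^'n) set)"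
    unfolding unitary_matrix_def by (rule closed_Collect_conj)
  moreover have "norm Q \<le> (\<Sum>i\<in>(UNIV::'n set). \<Sum>j\<in>(UNIV::'n set). 1)"
    if "unitary_matrix Q" for Q :: "complex^'n^'n"
  proof -
    have entry: "norm (Q $ i $ j) \<le> 1" for i j
    proof -
      have "(\<Sum>k\<in>UNIV. cnj (Q $ k $ j) * Q $ k $ j) = 1"
        using arg_cong[of _ _ "\<lambda>A. A $ j $ j", OF conjunct1[OF that[unfolded unitary_matrix_def]]]
        by (simp add: matrix_matrix_mult_def conj_transpose_def mat_def)
      then have "complex_of_real (\<Sum>k\<in>UNIV. (norm (Q $ k $ j))\<^sup>2) = 1"
        by (simp add: complex_norm_square mult.commute del: of_real_power)
      then have "(\<Sum>k\<in>UNIV. (norm (Q $ k $ j))\<^sup>2) = 1"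
        using of_real_eq_1_iff by blast
      moreover have "(norm (Q $ i $ j))\<^sup>2 \<le> (\<Sum>k\<in>UNIV. (norm (Q $ k $ j))\<^sup>2)"
        by (rule member_le_sum) auto
      ultimately show ?thesis
        by (simp add: abs_square_le_1)
    qed
    have row: "norm (Q $ i) \<le> (\<Sum>j\<in>(UNIV::'n set). 1)" for i
      unfolding norm_vec_def[of "Q $ i"]
      by (intro order_trans[OF L2_set_le_sum] sum_mono entry) auto
    show ?thesis
      unfolding norm_vec_def[of Q]
      by (intro order_trans[OF L2_set_le_sum] sum_mono row) auto
  qed
  then have "bounded (Collect unitary_matrix :: (complex^'n^'n) set)"
    unfolding bounded_iff by blast
  ultimately show ?thesis
    by (simp add: compact_eq_bounded_closed)
qed

lemma matrix_w_max:
  fixes H :: "nat \<Rightarrow> complex^'d^'d"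
  defines "U \<equiv> Collect unitary_matrix :: (complex^'d^'d) set"
  shows "\<exists>Q \<in> U \<times> U \<times> U. matrix_w n H = alignment_term n H Q \<and>
    (\<forall>R \<in> U \<times> U \<times> U. alignment_term n H R \<le> alignment_term n H Q)"
proof -
  have "mat 1 \<in> U"
  proof -
    have "conj_transpose (mat 1) = (mat 1 :: complex^'d^'d)"
      by (auto simp: conj_transpose_def mat_def vec_eq_iff)
    then show ?thesis
      by (simp add: U_def unitary_matrix_def)
  qed
  then have "U \<times> U \<times> U \<noteq> {}" by blast
  moreover have "compact (U \<times> U \<times> U)"
    unfolding U_def by (intro compact_Times compact_unitary)
  moreover have "continuous_on (U \<times> U \<times> U) (alignment_term n H)"
    unfolding alignment_term_def case_prod_beta by (intro continuous_intros)
  ultimately obtain Q where Q: "Q \<in> U \<times> U \<times> U"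
    "\<forall>R \<in> U \<times> U \<times> U. alignment_term n H R \<le> alignment_term n H Q"
    using continuous_attains_sup[of "U \<times> U \<times> U" "alignment_term n H"] by auto
  have "matrix_w n H = alignment_term n H Q"
    unfolding matrix_w_def U_def[symmetric] by (rule cSup_eq_maximum) (use Q in auto)
  with Q show ?thesis by blast
qed

end

theory Submission
  imports Defs
begin

text \<open>
  Moment method with two rounds of Gaussian integration by parts. The first one writes
  \<open>E tr X^(2p)\<close> as the sum over \<open>q\<close> of \<open>E \<Sum>\<^sub>i tr (H\<^sub>i X^q H\<^sub>i X^(2p-2-q))\<close>. In an eigenbasis of \<open>X\<close>,
  the four outermost terms are at most \<open>\<sigma>^2 tr X^(2p-2)\<close>, and a rearrangement inequality bounds the
  remaining \<open>2p-5\<close> terms by the one with \<open>q = 2\<close>. Integrating that term by parts once more gives a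
  nested term, at most \<open>\<sigma>^4 tr X^(2p-4)\<close>, and \<open>2p-4\<close> crossing terms
  \<open>\<Sum>\<^sub>i\<^sub>j tr (H\<^sub>i H\<^sub>j X H\<^sub>i X^r H\<^sub>j X^s)\<close>, each at most \<open>w^4 tr X^(2p-4)\<close>. The resulting recursion between
  the moments of order \<open>2p\<close>, \<open>2p-2\<close> and \<open>2p-4\<close> is solved by Young's inequality, and \<open>p\<close> is taken to
  be \<open>log d\<close> rounded up.
\<close>

section \<open>Spectral decomposition of Hermitian matrices\<close>

text \<open>Charging every term of the first round to \<sigma>^2 would put
  \<open>sqrt (ln d)\<close> in front of \<sigma>. To avoid this, the inner terms are lowered to
  exponent 2, the least positive even exponent: evenness makes the signs of the eigenvalues
  harmless. The main obstacle is that w controls unitary arguments only, while the crossing terms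
  carry powers of X. These are split into diagonal matrices with entries -1, 0, 1 in an eigenbasis
  of X, and each of those is an average of two unitaries. The cyclic word H_i . H_j . H_i . H_j .
  has four slots, one of them empty; of the other three, the factor with the smallest support stays
  outside the norm, where it merely counts eigenvectors. The recursion is not iterated. Any y > 0
  with y^2 >= 4 \<sigma>^2 y + (2p-5) (\<sigma>^4 + (2p-4) w^4) gives E tr X^(2p) <= d y^p after a
  single use. Since d <= e^p, this means E ||X|| <= sqrt(e y), which explains both the constant e
  and the choice y = s^2 / e.\<close>

definition cinner :: "complex^'n \<Rightarrow> complex^'n \<Rightarrow> complex" where
  "cinner u v = (\<Sum>i\<in>UNIV. cnj (u $ i) * v $ i)"

text \<open>The rank-one matrix \<open>u u^*\<close>, for a unit vector the orthogonal projection
  onto its line. Spectral decompositions are sums of these, so eigenvalues need no indexing.\<close>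

definition outer :: "complex^'n \<Rightarrow> complex^'n^'n" where
  "outer u = (\<chi> i j. u $ i * cnj (u $ j))"

lemma cinner_add_right: "cinner u (v + w) = cinner u v + cinner u w"
  by (simp add: cinner_def algebra_simps sum.distrib)

lemma cinner_diff_right: "cinner u (v - w) = cinner u v - cinner u w"
  by (simp add: cinner_def algebra_simps sum_subtractf)

lemma cinner_scaleC_right: "cinner u (c *s v) = c * cinner u v"
  by (simp add: cinner_def sum_distrib_left mult_ac)

lemma cinner_scaleR_right: "cinner u (r *\<^sub>R v) = of_real r * cinner u v"
  by (simp add: cinner_def sum_distrib_left) (simp add: scaleR_conv_of_real mult_ac)

lemma cinner_sum_right: "cinner u (\<Sum>i\<in>I. f i) = (\<Sum>i\<in>I. cinner u (f i))"
  by (induction I rule: infinite_finite_induct) (auto simp: cinner_add_right, auto simp: cinner_def)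

lemma cnj_cinner: "cnj (cinner u v) = cinner v u"
  by (simp add: cinner_def mult.commute)

lemma Re_cinner: "Re (cinner u v) = u \<bullet> v"
  by (simp add: cinner_def inner_vec_def inner_complex_def)

lemma cinner_self: "cinner u u = of_real ((norm u)\<^sup>2)"
proof -
  have "Im (cinner u u) = 0"
    using cnj_cinner[of u u] by (simp add: complex_eq_iff)
  then show ?thesis
    by (simp add: complex_eq_iff Re_cinner power2_norm_eq_inner)
qed

lemma cinner_adjoint: "cinner u (A *v v) = cinner (conj_transpose A *v u) v"
proof -
  have "cinner u (A *v v) = (\<Sum>i\<in>UNIV. \<Sum>j\<in>UNIV. cnj (u $ i) * (A $ i $ j * v $ j))"
    by (simp add: cinner_def matrix_vector_mult_def sum_distrib_left)
  also have "\<dots> = (\<Sum>j\<in>UNIV. \<Sum>i\<in>UNIV. cnj (u $ i) * (A $ i $ j * v $ j))"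
    by (rule sum.swap)
  also have "\<dots> = cinner (conj_transpose A *v u) v"
    by (simp add: cinner_def matrix_vector_mult_def conj_transpose_def sum_distrib_left sum_distrib_right mult_ac)
  finally show ?thesis .
qed

lemma cinner_hermitian: "hermitian_matrix A \<Longrightarrow> cinner u (A *v v) = cinner (A *v u) v"
  by (simp add: cinner_adjoint hermitian_matrix_def)

lemma outer_mult_vec: "outer u *v x = cinner u x *s u"
  by (simp add: outer_def matrix_vector_mult_def cinner_def vec_eq_iff sum_distrib_left mult_ac)

lemma trace_mult_outer: "trace (A ** outer u) = cinner u (A *v u)"
proof -
  have "trace (A ** outer u) = (\<Sum>i\<in>UNIV. \<Sum>k\<in>UNIV. A $ i $ k * (u $ k * cnj (u $ i)))"
    by (simp add: trace_def matrix_matrix_mult_def outer_def)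
  also have "\<dots> = cinner u (A *v u)"
    by (simp add: cinner_def matrix_vector_mult_def sum_distrib_left mult_ac)
  finally show ?thesis .
qed

lemma matrix_mult_scaleR_left: "(r *\<^sub>R A) ** B = r *\<^sub>R (A ** (B :: complex^'k^'m))"
  and matrix_mult_scaleR_right: "A ** (r *\<^sub>R B) = r *\<^sub>R (A ** (B :: complex^'k^'m))"
  for A :: "complex^'m^'n"
  by (simp_all add: matrix_matrix_mult_def vec_eq_iff scaleR_sum_right)

lemma matrix_vector_mult_scaleR_left: "(r *\<^sub>R A) *v x = r *\<^sub>R (A *v (x :: complex^'m))"
  for A :: "complex^'m^'n"
  by (simp add: matrix_vector_mult_def vec_eq_iff scaleR_sum_right)

lemma matrix_add_rdistrib: "(A + B) ** C = A ** C + B ** (C :: complex^'k^'m)"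
  for A B :: "complex^'m^'n"
  by (simp add: matrix_matrix_mult_def vec_eq_iff sum.distrib algebra_simps)

lemma matrix_mult_sum_left: "(\<Sum>i\<in>I. f i) ** B = (\<Sum>i\<in>I. f i ** (B :: complex^'k^'m))"
  for f :: "_ \<Rightarrow> complex^'m^'n"
  by (induction I rule: infinite_finite_induct) (auto simp: matrix_add_rdistrib)

lemma matrix_mult_sum_right: "B ** (\<Sum>i\<in>I. f i) = (\<Sum>i\<in>I. B ** f i)"
  for B :: "complex^'m^'n"
  by (induction I rule: infinite_finite_induct) (auto simp: matrix_add_ldistrib)

lemma matrix_vector_mult_sum_left: "(\<Sum>i\<in>I. f i) *v x = (\<Sum>i\<in>I. f i *v (x :: complex^'m))"
  for f :: "_ \<Rightarrow> complex^'m^'n"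
  by (induction I rule: infinite_finite_induct) (auto simp: matrix_vector_mult_add_rdistrib)

lemma trace_scaleR: "trace (r *\<^sub>R A) = r *\<^sub>R trace (A :: complex^'n^'n)"
  by (simp add: trace_def scaleR_sum_right)

lemma trace_sum: "trace (\<Sum>i\<in>I. f i) = (\<Sum>i\<in>I. trace (f i :: complex^'n^'n))"
  by (induction I rule: infinite_finite_induct) (auto simp: trace_add, auto simp: trace_def)

lemma outer_outer: "outer u ** A ** outer v = (\<chi> i j. cinner u (A *v v) * (u $ i * cnj (v $ j)))"
proof -
  have "(outer u ** A ** outer v) $ i $ j = cinner u (A *v v) * (u $ i * cnj (v $ j))" for i j
  proof -
    have "(outer u ** A ** outer v) $ i $ j = (outer u ** (A ** outer v)) $ i $ j"
      by (simp add: matrix_mul_assoc)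
    also have "\<dots> = (\<Sum>k\<in>UNIV. \<Sum>l\<in>UNIV. u $ i * cnj (u $ k) * (A $ k $ l * (v $ l * cnj (v $ j))))"
      by (simp add: matrix_matrix_mult_def outer_def sum_distrib_left)
    also have "\<dots> = cinner u (A *v v) * (u $ i * cnj (v $ j))"
      by (simp add: cinner_def matrix_vector_mult_def sum_distrib_left sum_distrib_right mult_ac)
    finally show ?thesis .
  qed
  then show ?thesis by (simp add: vec_eq_iff)
qed

lemma outer_mult_outer: "cinner u v = 0 \<Longrightarrow> outer u ** outer v = 0"
  and outer_idem: "cinner u u = 1 \<Longrightarrow> outer u ** outer u = outer u"
  using outer_outer[of u "mat 1" v] outer_outer[of u "mat 1" u]
  by (auto simp: vec_eq_iff outer_def)

section \<open>Orthonormal eigenvectors and the spectral theorem\<close>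

definition orthonormal_vecs :: "(complex^'n) set \<Rightarrow> bool" where
  "orthonormal_vecs S \<longleftrightarrow> (\<forall>u\<in>S. \<forall>v\<in>S. cinner u v = (if u = v then 1 else 0))"

lemma orthonormal_vecs_norm: "orthonormal_vecs S \<Longrightarrow> u \<in> S \<Longrightarrow> norm u = 1"
  using cinner_self[of u]
  by (metis of_real_eq_1_iff orthonormal_vecs_def power2_eq_1_iff abs_norm_cancel abs_neg_one)

text \<open>Complex orthogonality implies real orthogonality, so the real dimension is a bound.
  Being twice too large does no harm: it only serves to give finiteness and a uniform bound.\<close>

lemma orthonormal_vecs_bound:
  fixes S :: "(complex^'n) set"
  assumes "orthonormal_vecs S"
  shows "finite S" "card S \<le> DIM(complex^'n)"
proof -
  have "pairwise orthogonal S"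
    unfolding pairwise_def orthogonal_def Re_cinner[symmetric]
    using assms by (auto simp: orthonormal_vecs_def)
  moreover have "0 \<notin> S"
    using orthonormal_vecs_norm[OF assms] by force
  ultimately have "independent S"
    by (rule pairwise_orthogonal_independent)
  then show "finite S" "card S \<le> DIM(complex^'n)"
    using independent_bound[of S] by auto
qed

text \<open>Rayleigh quotient: the orthogonal complement \<open>V\<close> of \<open>S\<close> is
  invariant under \<open>X\<close>. If \<open>x\<close> maximizes
  \<open>x \<bullet> (X *v x)\<close> on its unit sphere, with value \<open>r\<close>, then
  \<open>r - X\<close> is positive semidefinite on \<open>V\<close> and its form vanishes at
  \<open>x\<close>, which forces \<open>X *v x = r *\<^sub>R x\<close>.\<close>

lemma hermitian_eigenvector_orthogonal:
  fixes X :: "complex^'n^'n"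
  assumes X: "hermitian_matrix X"
    and inv: "\<And>u. u \<in> S \<Longrightarrow> \<exists>r. X *v u = r *\<^sub>R u"
    and nz: "z \<noteq> 0" "\<And>u. u \<in> S \<Longrightarrow> cinner u z = 0"
  obtains x r where "norm x = 1" "\<And>u. u \<in> S \<Longrightarrow> cinner u x = 0" "X *v x = r *\<^sub>R x"
proof -
  define V where "V = {v. \<forall>u\<in>S. cinner u v = 0}"
  define K where "K = V \<inter> sphere 0 1"
  have "closed V"
  proof -
    have "V = (\<Inter>u\<in>S. {v. cinner u v = 0})" by (auto simp: V_def)
    moreover have "closed {v. cinner u v = 0}" for u :: "complex^'n"
      unfolding cinner_def by (intro closed_Collect_eq continuous_intros)
    ultimately show ?thesis by auto
  qed
  then have "compact K"
    unfolding K_def by (intro closed_Int_compact compact_sphere)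
  have addV: "v + w \<in> V" if "v \<in> V" "w \<in> V" for v w
    using that by (auto simp: V_def cinner_add_right)
  have scV: "r *\<^sub>R v \<in> V" if "v \<in> V" for v r
    using that by (auto simp: V_def cinner_scaleR_right)
  have XV: "X *v v \<in> V" if v: "v \<in> V" for v
    unfolding V_def mem_Collect_eq
  proof
    fix u assume u: "u \<in> S"
    obtain r where r: "X *v u = r *\<^sub>R u" using inv[OF u] by auto
    have "cinner u (X *v v) = cnj (cinner v (r *\<^sub>R u))"
      using cinner_hermitian[OF X, of u v] r by (simp add: cnj_cinner)
    then show "cinner u (X *v v) = 0"
      using v u by (simp add: cinner_scaleR_right cnj_cinner V_def)
  qed
  have "z \<in> V" using nz by (auto simp: V_def)
  have "(1 / norm z) *\<^sub>R z \<in> K"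
    using nz(1) scV[OF \<open>z \<in> V\<close>] by (auto simp: K_def)
  then have "K \<noteq> {}" by auto
  moreover have "continuous_on K (\<lambda>x. x \<bullet> (X *v x))"
    by (intro continuous_intros linear_continuous_on) simp
  ultimately obtain x where x: "x \<in> K" and max: "\<And>y. y \<in> K \<Longrightarrow> y \<bullet> (X *v y) \<le> x \<bullet> (X *v x)"
    using continuous_attains_sup[OF \<open>compact K\<close>] by metis
  define r where "r = x \<bullet> (X *v x)"
  define B where "B = (\<lambda>v. r *\<^sub>R v - X *v v)"
  have linB: "B (v + c *\<^sub>R w) = B v + c *\<^sub>R B w" for v w c
    by (simp add: B_def matrix_vector_right_distrib linear_scale[OF matrix_vector_mul_linear] algebra_simps)
  have scB: "B (c *\<^sub>R w) = c *\<^sub>R B w" for w c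
    using linB[of 0 c w] by (simp add: B_def)
  have symB: "v \<bullet> B w = w \<bullet> B v" for v w
  proof -
    have "v \<bullet> (X *v w) = w \<bullet> (X *v v)"
      using cinner_hermitian[OF X, of v w] by (metis Re_cinner inner_commute)
    then show ?thesis by (simp add: B_def inner_diff_right inner_commute)
  qed
  have posB: "0 \<le> v \<bullet> B v" if v: "v \<in> V" for v
  proof (cases "v = 0")
    case False
    define y where "y = (1 / norm v) *\<^sub>R v"
    have "y \<in> K" using False scV[OF v] by (auto simp: K_def y_def)
    have vy: "v = norm v *\<^sub>R y" using False by (simp add: y_def)
    have "y \<bullet> (X *v y) \<le> r" using max[OF \<open>y \<in> K\<close>] by (simp add: r_def)
    moreover have "y \<bullet> y = 1" using \<open>y \<in> K\<close> by (simp add: K_def norm_eq_1)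
    ultimately have "0 \<le> y \<bullet> B y" by (simp add: B_def inner_diff_right)
    moreover have "v \<bullet> B v = (norm v)\<^sup>2 * (y \<bullet> B y)"
      using scB[of "norm v" y] vy[symmetric] by (metis inner_scaleR_left inner_scaleR_right mult.assoc power2_eq_square)
    ultimately show ?thesis by simp
  qed (simp add: B_def)
  have xV: "x \<in> V" and nx: "norm x = 1" using x by (auto simp: K_def)
  have xBx: "x \<bullet> B x = 0"
    using nx by (simp add: B_def inner_diff_right r_def norm_eq_1)
  have BxV: "B x \<in> V"
    unfolding B_def using addV[OF scV[OF xV, of r] scV[OF XV[OF xV], of "-1"]] by simp
  \<comment> \<open>equality in the Cauchy--Schwarz inequality for the semidefinite form of \<open>B\<close>:
    a quadratic in \<open>c\<close> that is nonnegative and vanishes at 0 has no linear term\<close>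
  define w where "w = B x"
  have quad: "0 \<le> 2 * c * (w \<bullet> w) + c\<^sup>2 * (w \<bullet> B w)" for c
  proof -
    have "0 \<le> (x + c *\<^sub>R w) \<bullet> B (x + c *\<^sub>R w)"
      using posB addV[OF xV scV[OF BxV]] by (simp add: w_def)
    also have "\<dots> = 2 * c * (w \<bullet> w) + c\<^sup>2 * (w \<bullet> B w)"
      unfolding linB using symB[of x w] xBx
      by (simp add: inner_add_left inner_add_right power2_eq_square
          w_def[symmetric] algebra_simps del: scaleR_left_distrib)
    finally show ?thesis .
  qed
  have "w = 0"
  proof (rule ccontr)
    assume "w \<noteq> 0"
    then have n: "(w \<bullet> w) > 0" by simp
    define b where "b = w \<bullet> B w"
    have b: "b \<ge> 0" using posB[OF BxV] by (simp add: b_def w_def)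
    \<comment> \<open>A step size small enough that the linear term wins:
      \<open>b * k \<le> 1 < 2\<close>. The denominator \<open>b + 1\<close> also covers
      \<open>b = 0\<close>.\<close>
    define k where "k = 1 / (b + 1)"
    have k: "k > 0" "b * k \<le> 1" using b by (auto simp: k_def field_simps)
    define c where "c = - (w \<bullet> w) * k"
    have "2 * c * (w \<bullet> w) + c\<^sup>2 * b = (w \<bullet> w)\<^sup>2 * k * (b * k - 2)"
      by (simp add: c_def algebra_simps power2_eq_square)
    also have "\<dots> < 0"
      using k n by (intro mult_pos_neg) auto
    finally show False using quad[of c] by (simp add: b_def)
  qed
  then have "X *v x = r *\<^sub>R x" by (simp add: w_def B_def)
  then show ?thesis using that nx xV by (auto simp: V_def)
qed

definition orthonormal_basis :: "(complex^'n) set \<Rightarrow> bool" where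
  "orthonormal_basis S \<longleftrightarrow> orthonormal_vecs S \<and> (\<Sum>u\<in>S. outer u) = mat 1"

text \<open>Functional calculus in a fixed eigenbasis: pointwise products of \<open>f\<close> become
  matrix products. Since \<open>f\<close> lives on eigenvectors rather than eigenvalues,
  multiplicities need no treatment.\<close>

definition diagonal_in :: "(complex^'n) set \<Rightarrow> (complex^'n \<Rightarrow> real) \<Rightarrow> complex^'n^'n" where
  "diagonal_in S f = (\<Sum>u\<in>S. f u *\<^sub>R outer u)"

text \<open>An orthonormal set of eigenvectors of largest cardinality is complete: a nonzero vector
  orthogonal to it would yield one more eigenvector.\<close>

theorem hermitian_diagonalization:
  fixes X :: "complex^'n^'n"
  assumes X: "hermitian_matrix X"
  obtains S f where "orthonormal_basis S" "X = diagonal_in S f"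
proof -
  define P where "P = (\<lambda>S. orthonormal_vecs S \<and> (\<forall>u\<in>S. \<exists>r. X *v u = r *\<^sub>R u))"
  have P0: "P {}" by (simp add: P_def orthonormal_vecs_def)
  have Pb: "\<forall>S. P S \<longrightarrow> card S < Suc DIM(complex^'n)"
    using orthonormal_vecs_bound unfolding less_Suc_eq_le by (auto simp: P_def simp del: DIM_cart)
  obtain S where S: "P S" "\<And>T. P T \<Longrightarrow> card T \<le> card S"
    using ex_has_greatest_nat[of P "{}" card, OF P0 Pb] by auto
  have o: "orthonormal_vecs S" and e: "\<And>u. u \<in> S \<Longrightarrow> \<exists>r. X *v u = r *\<^sub>R u"
    using S(1) by (auto simp: P_def)
  have fin: "finite S" using orthonormal_vecs_bound[OF o] by simp
  have triv: "z = 0" if z: "\<And>u. u \<in> S \<Longrightarrow> cinner u z = 0" for z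
  proof (rule ccontr)
    assume "z \<noteq> 0"
    then obtain x r where x: "norm x = 1" "\<And>u. u \<in> S \<Longrightarrow> cinner u x = 0" "X *v x = r *\<^sub>R x"
      using hermitian_eigenvector_orthogonal[OF X e, of S z] z by blast
    have xx: "cinner x x = 1" using x(1) by (simp add: cinner_self)
    have "x \<notin> S" using x(2)[of x] xx by auto
    have "cinner x u = 0" if "u \<in> S" for u
      using x(2)[OF that] cnj_cinner[of u x] by simp
    then have "P (insert x S)"
      using o e x xx \<open>x \<notin> S\<close> by (auto simp: P_def orthonormal_vecs_def)
    from S(2)[OF this] show False using \<open>x \<notin> S\<close> fin by simp
  qed
  have complete: "(\<Sum>u\<in>S. outer u) *v v = v" for v
  proof -
    have "cinner u (v - (\<Sum>u\<in>S. outer u) *v v) = 0" if u: "u \<in> S" for u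
    proof -
      have "cinner u ((\<Sum>u\<in>S. outer u) *v v) = (\<Sum>w\<in>S. cinner w v * cinner u w)"
        by (simp add: matrix_vector_mult_sum_left outer_mult_vec cinner_sum_right cinner_scaleC_right)
      also have "\<dots> = (\<Sum>w\<in>S. if u = w then cinner w v else 0)"
        using o u by (intro sum.cong) (auto simp: orthonormal_vecs_def)
      also have "\<dots> = cinner u v" using u fin by simp
      finally show ?thesis by (simp add: cinner_diff_right)
    qed
    from triv[OF this] show ?thesis by simp
  qed
  then have one: "(\<Sum>u\<in>S. outer u) = mat 1"
    by (simp add: matrix_eq)
  obtain f where f: "\<And>u. u \<in> S \<Longrightarrow> X *v u = f u *\<^sub>R u" using e by metis
  have "X *v v = diagonal_in S f *v v" for v
  proof -
    have "X *v v = X *v ((\<Sum>u\<in>S. outer u) *v v)" by (simp add: complete)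
    also have "\<dots> = (\<Sum>u\<in>S. X *v (cinner u v *s u))"
      by (simp add: matrix_vector_mult_sum_left outer_mult_vec vec.sum)
    also have "\<dots> = (\<Sum>u\<in>S. f u *\<^sub>R (cinner u v *s u))"
      by (intro sum.cong refl) (simp add: vec.scale f, simp add: vec_eq_iff)
    also have "\<dots> = diagonal_in S f *v v"
      by (simp add: diagonal_in_def matrix_vector_mult_sum_left matrix_vector_mult_scaleR_left outer_mult_vec)
    finally show ?thesis .
  qed
  then have "X = diagonal_in S f" by (simp add: matrix_eq)
  with o one that show ?thesis by (auto simp: orthonormal_basis_def)
qed

section \<open>Traces of powers of Hermitian matrices\<close>

lemma orthonormal_basis_finite: "orthonormal_basis S \<Longrightarrow> finite S"
  using orthonormal_vecs_bound by (auto simp: orthonormal_basis_def)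

lemma diagonal_in_mult:
  assumes S: "orthonormal_basis S"
  shows "diagonal_in S f ** diagonal_in S g = diagonal_in S (\<lambda>u. f u * g u)"
proof -
  have fin: "finite S" using orthonormal_basis_finite[OF S] .
  have o: "outer u ** outer v = (if u = v then outer u else 0)" if "u \<in> S" "v \<in> S" for u v
    using that S outer_idem[of u] outer_mult_outer[of u v]
    by (auto simp: orthonormal_basis_def orthonormal_vecs_def)
  have "diagonal_in S f ** diagonal_in S g = (\<Sum>u\<in>S. \<Sum>v\<in>S. (f u * g v) *\<^sub>R (outer u ** outer v))"
    by (simp add: diagonal_in_def matrix_mult_sum_left matrix_mult_sum_right
        matrix_mult_scaleR_left matrix_mult_scaleR_right scaleR_sum_right mult.commute, rule sum.swap)
  also have "\<dots> = (\<Sum>u\<in>S. \<Sum>v\<in>S. if u = v then (f u * g u) *\<^sub>R outer u else 0)"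
    using o by (intro sum.cong refl) (auto simp: mult.commute)
  also have "\<dots> = diagonal_in S (\<lambda>u. f u * g u)"
    using fin by (simp add: diagonal_in_def)
  finally show ?thesis .
qed

lemma diagonal_in_one: "orthonormal_basis S \<Longrightarrow> diagonal_in S (\<lambda>u. 1) = mat 1"
  by (simp add: diagonal_in_def orthonormal_basis_def)

lemma diagonal_in_cong: "(\<And>u. u \<in> S \<Longrightarrow> f u = g u) \<Longrightarrow> diagonal_in S f = diagonal_in S g"
  by (simp add: diagonal_in_def)

lemma diagonal_in_sum:
  "diagonal_in S (\<lambda>u. \<Sum>t\<in>T. a t * f t u) = (\<Sum>t\<in>T. a t *\<^sub>R diagonal_in S (f t))"
  by (simp add: diagonal_in_def scaleR_sum_left scaleR_sum_right sum.swap[of _ T S])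

lemma conj_transpose_diagonal_in: "conj_transpose (diagonal_in S f) = diagonal_in S f"
  by (simp add: conj_transpose_def diagonal_in_def outer_def vec_eq_iff cnj_sum scaleR_conv_of_real[where 'a=complex] mult_ac)

lemma unitary_diagonal_in:
  assumes "orthonormal_basis S" "\<And>u. u \<in> S \<Longrightarrow> f u * f u = 1"
  shows "unitary_matrix (diagonal_in S f)"
proof -
  have "diagonal_in S f ** diagonal_in S f = mat 1"
    unfolding diagonal_in_mult[OF assms(1)] diagonal_in_one[OF assms(1), symmetric]
    by (rule diagonal_in_cong) (rule assms(2))
  then show ?thesis by (simp add: unitary_matrix_def conj_transpose_diagonal_in)
qed

primrec matpow :: "complex^'n^'n \<Rightarrow> nat \<Rightarrow> complex^'n^'n" where
  "matpow A 0 = mat 1"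
| "matpow A (Suc k) = A ** matpow A k"

lemma matpow_diagonal_in:
  "orthonormal_basis S \<Longrightarrow> matpow (diagonal_in S f) k = diagonal_in S (\<lambda>u. f u ^ k)"
  by (induction k) (auto simp: diagonal_in_one diagonal_in_mult)

lemma trace_mult_diagonal_in: "trace (A ** diagonal_in S f) = (\<Sum>u\<in>S. f u *\<^sub>R cinner u (A *v u))"
  by (simp add: diagonal_in_def matrix_mult_sum_right matrix_mult_scaleR_right trace_sum trace_scaleR
      trace_mult_outer)

lemma trace_diagonal_in:
  assumes "orthonormal_basis S"
  shows "trace (diagonal_in S f) = of_real (\<Sum>u\<in>S. f u)"
  using trace_mult_diagonal_in[of "mat 1" S f] assms
  by (auto simp: orthonormal_basis_def orthonormal_vecs_def scaleR_conv_of_real[where 'a=complex])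

text \<open>Trace of the resolution of the identity. This is the source of the dimension factor in
  the moment bound.\<close>

lemma orthonormal_basis_card:
  fixes S :: "(complex^'n) set"
  assumes "orthonormal_basis S"
  shows "card S = CARD('n)"
proof -
  have "complex_of_real (real (card S)) = of_nat (CARD('n))"
    using trace_diagonal_in[OF assms, of "\<lambda>_. 1"] diagonal_in_one[OF assms] trace_I[where 'a=complex and 'n='n]
    by simp
  then show ?thesis by (metis of_nat_eq_iff of_real_of_nat_eq)
qed

text \<open>The entries of \<open>A\<close> in the eigenbasis enter only through their squared
  moduli. These nonnegative coefficients allow scalar inequalities between eigenvalues to be lifted
  to traces.\<close>

lemma trace_sandwich:
  assumes "hermitian_matrix A"
  shows "Re (trace (A ** diagonal_in S f ** A ** diagonal_in S g)) =
    (\<Sum>v\<in>S. \<Sum>u\<in>S. f u * g v * (cmod (cinner u (A *v v)))\<^sup>2)"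
proof -
  have "cinner v (A *v (diagonal_in S f *v (A *v v))) = (\<Sum>u\<in>S. f u *\<^sub>R (cinner u (A *v v) * cnj (cinner u (A *v v))))" for v
  proof -
    have "cinner v (A *v (diagonal_in S f *v (A *v v))) = cinner (A *v v) (diagonal_in S f *v (A *v v))"
      by (simp add: cinner_hermitian[OF assms])
    also have "\<dots> = (\<Sum>u\<in>S. f u *\<^sub>R (cinner u (A *v v) * cinner (A *v v) u))"
      by (simp add: diagonal_in_def matrix_vector_mult_sum_left matrix_vector_mult_scaleR_left outer_mult_vec
          cinner_sum_right cinner_scaleR_right cinner_scaleC_right scaleR_conv_of_real[where 'a=complex])
    finally show ?thesis by (simp add: cnj_cinner)
  qed
  then show ?thesis
    unfolding trace_mult_diagonal_in
    by (simp add: matrix_vector_mul_assoc[symmetric] complex_norm_square[symmetric] sum_distrib_left mult_ac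
        del: of_real_power)
qed

lemma inner_diagonal_in: "v \<bullet> (diagonal_in S f *v v) = (\<Sum>u\<in>S. f u * (cmod (cinner u v))\<^sup>2)"
proof -
  have "v \<bullet> (diagonal_in S f *v v) = Re (cinner v (diagonal_in S f *v v))"
    by (simp add: Re_cinner)
  also have "cinner v (diagonal_in S f *v v) = (\<Sum>u\<in>S. f u *\<^sub>R (cinner u v * cinner v u))"
    by (simp add: diagonal_in_def matrix_vector_mult_sum_left matrix_vector_mult_scaleR_left outer_mult_vec
          cinner_sum_right cinner_scaleR_right cinner_scaleC_right scaleR_conv_of_real[where 'a=complex])
  also have "\<dots> = (\<Sum>u\<in>S. f u *\<^sub>R (cinner u v * cnj (cinner u v)))"
    by (simp add: cnj_cinner)
  also have "Re \<dots> = (\<Sum>u\<in>S. f u * (cmod (cinner u v))\<^sup>2)"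
    by (simp add: complex_norm_square[symmetric] del: of_real_power)
  finally show ?thesis .
qed

section \<open>Spectral norm, eigenvalues and trace inequalities\<close>

lemma spectral_norm_nonneg: "0 \<le> spectral_norm A"
  by (simp add: spectral_norm_def onorm_pos_le)

lemma norm_mult_le_spectral_norm: "norm (A *v v) \<le> spectral_norm A * norm v"
  by (simp add: spectral_norm_def onorm)

lemma abs_inner_le_spectral_norm: "\<bar>u \<bullet> (A *v u)\<bar> \<le> spectral_norm A * (norm u)\<^sup>2"
proof -
  have "\<bar>u \<bullet> (A *v u)\<bar> \<le> norm u * norm (A *v u)" by (rule Cauchy_Schwarz_ineq2)
  also have "\<dots> \<le> norm u * (spectral_norm A * norm u)"
    by (intro mult_left_mono norm_mult_le_spectral_norm) simp
  finally show ?thesis by (simp add: power2_eq_square mult_ac)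
qed

lemma spectral_norm_average:
  assumes "spectral_norm A \<le> w" "spectral_norm B \<le> w"
  shows "spectral_norm ((1/2) *\<^sub>R (A + B)) \<le> w"
proof -
  have "(*v) ((1/2) *\<^sub>R (A + B)) = (\<lambda>v. (1/2) *\<^sub>R (A *v v + B *v v))"
    by (simp add: fun_eq_iff matrix_vector_mult_scaleR_left matrix_vector_mult_add_rdistrib del: scaleR_add_right)
  then have "spectral_norm ((1/2) *\<^sub>R (A + B)) = (1/2) * onorm (\<lambda>v. A *v v + B *v v)"
    by (simp add: spectral_norm_def onorm_scaleR bounded_linear_add del: scaleR_add_right)
  also have "\<dots> \<le> (1/2) * (spectral_norm A + spectral_norm B)"
    unfolding spectral_norm_def by (intro mult_left_mono onorm_triangle) auto
  finally show ?thesis using assms by simp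
qed

text \<open>The norm is at most the largest modulus of an eigenvalue, whose even power is one
  summand of a nonnegative sum.\<close>

lemma spectral_norm_power_le_trace:
  fixes X :: "complex^'n^'n"
  assumes "hermitian_matrix X" "even k"
  shows "spectral_norm X ^ k \<le> Re (trace (matpow X k))"
proof -
  obtain S f where S: "orthonormal_basis S" and X: "X = diagonal_in S f"
    using hermitian_diagonalization[OF assms(1)] .
  have fin: "finite S" and ne: "S \<noteq> {}"
    using orthonormal_basis_finite[OF S] orthonormal_basis_card[OF S] by auto
  have "Max ((\<lambda>u. \<bar>f u\<bar>) ` S) \<in> (\<lambda>u. \<bar>f u\<bar>) ` S"
    using fin ne by (intro Max_in) auto
  then obtain u0 where u0: "u0 \<in> S" "\<bar>f u0\<bar> = Max ((\<lambda>u. \<bar>f u\<bar>) ` S)" by auto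
  then have max: "\<bar>f u\<bar> \<le> \<bar>f u0\<bar>" if "u \<in> S" for u
    using fin that by auto
  have "norm (X *v v) \<le> \<bar>f u0\<bar> * norm v" for v
  proof -
    have "(norm (X *v v))\<^sup>2 = v \<bullet> (X *v (X *v v))"
      using cinner_hermitian[OF assms(1), of v "X *v v"]
      by (metis Re_cinner power2_norm_eq_inner)
    also have "X *v (X *v v) = diagonal_in S (\<lambda>u. f u * f u) *v v"
      by (simp add: X matrix_vector_mul_assoc diagonal_in_mult[OF S])
    also have "v \<bullet> \<dots> = (\<Sum>u\<in>S. f u * f u * (cmod (cinner u v))\<^sup>2)"
      by (rule inner_diagonal_in)
    also have "\<dots> \<le> (\<Sum>u\<in>S. (f u0)\<^sup>2 * (cmod (cinner u v))\<^sup>2)"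
      using max by (intro sum_mono mult_right_mono)
        (auto simp: power2_eq_square[symmetric] abs_le_square_iff)
    also have "\<dots> = (f u0)\<^sup>2 * (v \<bullet> (diagonal_in S (\<lambda>_. 1) *v v))"
      by (simp add: inner_diagonal_in sum_distrib_left)
    also have "\<dots> = (\<bar>f u0\<bar> * norm v)\<^sup>2"
      by (simp add: diagonal_in_one[OF S] power_mult_distrib power2_norm_eq_inner)
    finally show ?thesis by (rule power2_le_imp_le) simp
  qed
  then have "spectral_norm X \<le> \<bar>f u0\<bar>"
    unfolding spectral_norm_def by (intro onorm_bound) auto
  then have "spectral_norm X ^ k \<le> \<bar>f u0\<bar> ^ k"
    by (intro power_mono spectral_norm_nonneg)
  also have "\<dots> = f u0 ^ k" using assms(2) by (simp add: power_even_abs)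
  also have "\<dots> \<le> (\<Sum>u\<in>S. f u ^ k)"
    using u0(1) fin assms(2) by (intro member_le_sum) (auto simp: zero_le_even_power)
  also have "\<dots> = Re (trace (matpow X k))"
    by (simp add: X matpow_diagonal_in[OF S] trace_diagonal_in[OF S] del: of_real_sum)
  finally show ?thesis .
qed

text \<open>In the eigenbasis of \<open>X\<close> the left side combines the numbers
  \<open>u \<bullet> (A *v u)\<close> with weights \<open>f u ^ k\<close>, nonnegative because
  \<open>k\<close> is even.\<close>

lemma trace_mult_matpow_le:
  assumes "hermitian_matrix X" "even k"
    and le: "\<And>u. norm u = 1 \<Longrightarrow> u \<bullet> (A *v u) \<le> c"
  shows "Re (trace (A ** matpow X k)) \<le> c * Re (trace (matpow X k))"
proof -
  obtain S f where S: "orthonormal_basis S" and X: "X = diagonal_in S f"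
    using hermitian_diagonalization[OF assms(1)] .
  have "Re (trace (A ** matpow X k)) = (\<Sum>u\<in>S. f u ^ k * (u \<bullet> (A *v u)))"
    by (simp add: X matpow_diagonal_in[OF S] trace_mult_diagonal_in Re_cinner)
  also have "\<dots> \<le> (\<Sum>u\<in>S. f u ^ k * c)"
    using S assms(2) orthonormal_vecs_norm
    by (intro sum_mono mult_left_mono le) (auto simp: orthonormal_basis_def zero_le_even_power)
  also have "\<dots> = c * Re (trace (matpow X k))"
    by (simp add: X matpow_diagonal_in[OF S] trace_diagonal_in[OF S] sum_distrib_left mult.commute
        del: of_real_sum)
  finally show ?thesis .
qed

text \<open>Pass to moduli s, t and factor out (s t)^m; what remains is (s^c - t^c)(s^d - t^d) >= 0.
  The parities make the right side insensitive to signs, while \<open>a\<close> and \<open>b\<close>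
  themselves may both be odd.\<close>

lemma power_rearrange:
  fixes x y :: real
  assumes "even m" "even (a + b)" "m \<le> a" "m \<le> b"
  shows "x ^ a * y ^ b + y ^ a * x ^ b \<le> x ^ m * y ^ (a + b - m) + y ^ m * x ^ (a + b - m)"
proof -
  define s t where "s = \<bar>x\<bar>" and "t = \<bar>y\<bar>"
  have st: "s \<ge> 0" "t \<ge> 0" by (auto simp: s_def t_def)
  obtain c where c: "a = m + c" using assms(3) le_Suc_ex by blast
  obtain d where d: "b = m + d" using assms(4) le_Suc_ex by blast
  have "0 \<le> (s ^ c - t ^ c) * (s ^ d - t ^ d)"
  proof (cases "s \<le> t")
    case True
    then show ?thesis using st by (intro mult_nonpos_nonpos) (auto intro: power_mono)
  next
    case False
    then show ?thesis using st by (intro mult_nonneg_nonneg) (auto intro: power_mono)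
  qed
  then have *: "s ^ c * t ^ d + t ^ c * s ^ d \<le> t ^ (c + d) + s ^ (c + d)"
    by (simp add: algebra_simps power_add)
  have "x ^ a * y ^ b + y ^ a * x ^ b \<le> s ^ a * t ^ b + t ^ a * s ^ b"
    unfolding s_def t_def power_abs[symmetric] abs_mult[symmetric] by (intro add_mono) auto
  also have "\<dots> = (s ^ m * t ^ m) * (s ^ c * t ^ d + t ^ c * s ^ d)"
    by (simp add: c d power_add algebra_simps)
  also have "\<dots> \<le> (s ^ m * t ^ m) * (t ^ (c + d) + s ^ (c + d))"
    using st by (intro mult_left_mono *) auto
  also have "\<dots> = s ^ m * t ^ (a + b - m) + t ^ m * s ^ (a + b - m)"
    by (simp add: c d power_add algebra_simps)
  also have "\<dots> = x ^ m * y ^ (a + b - m) + y ^ m * x ^ (a + b - m)"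
    using assms by (simp add: s_def t_def power_even_abs)
  finally show ?thesis .
qed

text \<open>The coefficients |<u, A v>|^2 are symmetric in u and v. Symmetrizing the double sum over
  eigenvectors produces exactly the two-term form of \<open>power_rearrange\<close>.\<close>

lemma trace_sandwich_le:
  assumes A: "hermitian_matrix A" and X: "hermitian_matrix X"
    and "even m" "even (a + b)" "m \<le> a" "m \<le> b"
  shows "Re (trace (A ** matpow X a ** A ** matpow X b))
    \<le> Re (trace (A ** matpow X m ** A ** matpow X (a + b - m)))"
proof -
  obtain S f where S: "orthonormal_basis S" and X: "X = diagonal_in S f"
    using hermitian_diagonalization[OF assms(2)] .
  define c where "c = (\<lambda>u v. (cmod (cinner u (A *v v)))\<^sup>2)"
  have c_sym: "c u v = c v u" for u v
    unfolding c_def using cinner_hermitian[OF A, of u v] cnj_cinner[of v "A *v u"]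
    by (metis complex_mod_cnj)
  have sw: "2 * Re (trace (A ** matpow X a ** A ** matpow X b)) =
      (\<Sum>v\<in>S. \<Sum>u\<in>S. c u v * (f u ^ a * f v ^ b + f v ^ a * f u ^ b))" for a b
  proof -
    have e: "Re (trace (A ** matpow X a ** A ** matpow X b)) = (\<Sum>v\<in>S. \<Sum>u\<in>S. c u v * (f u ^ a * f v ^ b))"
      by (simp add: X matpow_diagonal_in[OF S] trace_sandwich[OF A] c_def mult_ac)
    also have "\<dots> = (\<Sum>v\<in>S. \<Sum>u\<in>S. c u v * (f v ^ a * f u ^ b))"
      by (subst sum.swap) (simp add: c_sym)
    finally show ?thesis using e by (simp add: sum.distrib algebra_simps)
  qed
  have "2 * Re (trace (A ** matpow X a ** A ** matpow X b))
      \<le> 2 * Re (trace (A ** matpow X m ** A ** matpow X (a + b - m)))"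
    unfolding sw by (intro sum_mono mult_left_mono power_rearrange assms) (simp add: c_def)
  then show ?thesis by simp
qed

section \<open>Crossing terms and the alignment parameter\<close>

text \<open>The matrix inside \<open>alignment_term\<close>, with arbitrary arguments in the slots
  of the unitaries so that linearity becomes available.\<close>

definition crossing ::
  "nat \<Rightarrow> (nat \<Rightarrow> complex^'d^'d) \<Rightarrow> complex^'d^'d \<Rightarrow> complex^'d^'d \<Rightarrow> complex^'d^'d \<Rightarrow> complex^'d^'d" where
  "crossing n H A B C = (\<Sum>i=1..n. \<Sum>j=1..n. H i ** A ** H j ** B ** H i ** C ** H j)"

lemma crossing_linear:
  "linear (\<lambda>A. crossing n H A B C)" "linear (\<lambda>B. crossing n H A B C)" "linear (\<lambda>C. crossing n H A B C)"
  by (rule linearI; simp add: crossing_def matrix_add_ldistrib matrix_add_rdistrib sum.distrib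
      matrix_mult_scaleR_left matrix_mult_scaleR_right scaleR_sum_right)+

definition unitary_average :: "complex^'n^'n \<Rightarrow> bool" where
  "unitary_average A \<longleftrightarrow> (\<exists>U V. unitary_matrix U \<and> unitary_matrix V \<and> A = (1/2) *\<^sub>R (U + V))"

lemma spectral_norm_crossing_unitary:
  assumes "unitary_matrix A" "unitary_matrix B" "unitary_matrix C"
  shows "spectral_norm (crossing n H A B C) \<le> matrix_w n H ^ 4"
proof -
  have "alignment_term n H (A, B, C) \<le> matrix_w n H"
    using matrix_w_max[of n H] assms by auto
  then have "root 4 (spectral_norm (crossing n H A B C)) \<le> matrix_w n H"
    by (simp add: alignment_term_def crossing_def)
  then have "root 4 (spectral_norm (crossing n H A B C)) ^ 4 \<le> matrix_w n H ^ 4"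
    by (intro power_mono) (auto simp: spectral_norm_nonneg)
  then show ?thesis by (simp add: spectral_norm_nonneg)
qed

text \<open>The matrix is linear in each slot and the norm is convex, so the slots can be reduced to
  unitaries one at a time; eight unitary triples remain.\<close>

lemma spectral_norm_crossing_average:
  assumes "unitary_average A" "unitary_average B" "unitary_average C"
  shows "spectral_norm (crossing n H A B C) \<le> matrix_w n H ^ 4"
proof -
  have half: "spectral_norm (F ((1/2) *\<^sub>R (U + V))) \<le> w"
    if "linear F" "spectral_norm (F U) \<le> w" "spectral_norm (F V) \<le> w"
    for F :: "complex^'a^'a \<Rightarrow> complex^'a^'a" and U V w
    using spectral_norm_average[OF that(2,3)]
    by (simp only: linear_add[OF that(1)] linear_scale[OF that(1)])
  obtain A1 A2 B1 B2 C1 C2 where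
    "unitary_matrix A1" "unitary_matrix A2" and A: "A = (1/2) *\<^sub>R (A1 + A2)" and
    "unitary_matrix B1" "unitary_matrix B2" and B: "B = (1/2) *\<^sub>R (B1 + B2)" and
    "unitary_matrix C1" "unitary_matrix C2" and C: "C = (1/2) *\<^sub>R (C1 + C2)"
    using assms unfolding unitary_average_def by metis
  then show ?thesis
    unfolding A B C
    by (intro half[OF crossing_linear(1)] half[OF crossing_linear(2)] half[OF crossing_linear(3)]
        spectral_norm_crossing_unitary)
qed

text \<open>Each entry 0 is the mean of 1 and -1; entries of modulus one are left alone.\<close>

lemma unitary_average_diagonal_in:
  assumes "orthonormal_basis S" "\<And>u. u \<in> S \<Longrightarrow> f u \<in> {-1, 0, 1}"
  shows "unitary_average (diagonal_in S f)"
proof -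
  define g h where "g = (\<lambda>u. if f u = 0 then 1 else f u)" and "h = (\<lambda>u. if f u = 0 then -1 else f u)"
  have "unitary_matrix (diagonal_in S g)" "unitary_matrix (diagonal_in S h)"
    using assms(2) by (fastforce intro!: unitary_diagonal_in[OF assms(1)] simp: g_def h_def)+
  moreover have "diagonal_in S f = (1/2) *\<^sub>R (diagonal_in S g + diagonal_in S h)"
    unfolding diagonal_in_def sum.distrib[symmetric] scaleR_sum_right
    by (intro sum.cong refl) (auto simp: g_def h_def scaleR_left_distrib[symmetric])
  ultimately show ?thesis unfolding unitary_average_def by blast
qed

lemma unitary_average_one: "unitary_average (mat 1 :: complex^'n^'n)"
proof -
  have "conj_transpose (mat 1) = (mat 1 :: complex^'n^'n)"
    by (auto simp: conj_transpose_def mat_def vec_eq_iff)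
  then have "unitary_matrix (mat 1 :: complex^'n^'n)"
    by (simp add: unitary_matrix_def)
  moreover have "mat 1 = (1/2) *\<^sub>R (mat 1 + mat 1 :: complex^'n^'n)"
    by (simp only: scaleR_half_double)
  ultimately show ?thesis unfolding unitary_average_def by blast
qed

text \<open>The cyclic word H_i . H_j . H_i . H_j . as it arises from the second integration by
  parts: one slot is empty, hence \<open>mat 1\<close>, and the other three hold powers of
  X.\<close>

definition crossing_trace ::
  "nat \<Rightarrow> (nat \<Rightarrow> complex^'d^'d) \<Rightarrow> complex^'d^'d \<Rightarrow> complex^'d^'d \<Rightarrow> complex^'d^'d \<Rightarrow> real" where
  "crossing_trace n H A B C = Re (trace (crossing n H (mat 1) A B ** C))"

text \<open>Moving \<open>H i ** A\<close> to the end leaves a word that begins with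
  \<open>H j\<close>. As the word alternates, exchanging the names i and j restores the
  pattern.\<close>

lemma trace_crossing_cyclic:
  "trace (crossing n H A B C ** D) = trace (crossing n H B C D ** A)"
proof -
  have "trace (crossing n H A B C ** D) = (\<Sum>i=1..n. \<Sum>j=1..n. trace (H i ** A ** H j ** B ** H i ** C ** H j ** D))"
    by (simp add: crossing_def matrix_mult_sum_left trace_sum)
  also have "\<dots> = (\<Sum>i=1..n. \<Sum>j=1..n. trace (H j ** B ** H i ** C ** H j ** D ** H i ** A))"
  proof (intro sum.cong refl)
    fix i j
    have "trace ((H i ** A) ** (H j ** B ** H i ** C ** H j ** D)) = trace ((H j ** B ** H i ** C ** H j ** D) ** (H i ** A))"
      by (rule trace_mul_sym)
    then show "trace (H i ** A ** H j ** B ** H i ** C ** H j ** D) = trace (H j ** B ** H i ** C ** H j ** D ** H i ** A)"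
      by (simp add: matrix_mul_assoc)
  qed
  also have "\<dots> = (\<Sum>i=1..n. \<Sum>j=1..n. trace (H i ** B ** H j ** C ** H i ** D ** H j ** A))"
    by (rule sum.swap)
  also have "\<dots> = trace (crossing n H B C D ** A)"
    by (simp add: crossing_def matrix_mult_sum_left trace_sum)
  finally show ?thesis .
qed

text \<open>The factor outside the norm selects the basis vectors in its support, and each
  contributes at most the norm of the crossing matrix. The bound therefore scales with the support
  instead of the dimension.\<close>

lemma abs_trace_crossing_diagonal_le:
  assumes S: "orthonormal_basis S"
    and "unitary_average A" "unitary_average B" "unitary_average C"
    and f: "\<And>u. u \<in> S \<Longrightarrow> f u \<in> {-1, 0, 1}"
  shows "\<bar>Re (trace (crossing n H A B C ** diagonal_in S f))\<bar> \<le> matrix_w n H ^ 4 * real (card {u \<in> S. f u \<noteq> 0})"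
proof -
  let ?Z = "crossing n H A B C" and ?W = "matrix_w n H ^ 4"
  have fin: "finite S" by (rule orthonormal_basis_finite[OF S])
  have "\<bar>Re (trace (?Z ** diagonal_in S f))\<bar> = \<bar>\<Sum>u\<in>S. f u * (u \<bullet> (?Z *v u))\<bar>"
    by (simp add: trace_mult_diagonal_in Re_cinner)
  also have "\<dots> \<le> (\<Sum>u\<in>S. \<bar>f u * (u \<bullet> (?Z *v u))\<bar>)"
    by (rule sum_abs)
  also have "\<dots> \<le> (\<Sum>u\<in>S. if f u \<noteq> 0 then ?W else 0)"
  proof (rule sum_mono)
    fix u assume u: "u \<in> S"
    have "\<bar>u \<bullet> (?Z *v u)\<bar> \<le> spectral_norm ?Z"
      using abs_inner_le_spectral_norm[of u ?Z] orthonormal_vecs_norm[of S u] S u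
      by (simp add: orthonormal_basis_def)
    also have "\<dots> \<le> ?W" by (intro spectral_norm_crossing_average assms)
    finally show "\<bar>f u * (u \<bullet> (?Z *v u))\<bar> \<le> (if f u \<noteq> 0 then ?W else 0)"
      using f[OF u] by (auto simp: abs_mult)
  qed
  also have "\<dots> = ?W * real (card {u \<in> S. f u \<noteq> 0})"
    using fin by (simp add: sum.If_cases mult.commute Collect_conj_eq Int_commute)
  finally show ?thesis .
qed

text \<open>Cyclicity moves any of the three factors to the outermost place, so the smallest support
  can be chosen.\<close>

lemma abs_crossing_trace_diagonal_le:
  assumes S: "orthonormal_basis S"
    and f: "\<And>u. u \<in> S \<Longrightarrow> f u \<in> {-1, 0, 1}"
    and g: "\<And>u. u \<in> S \<Longrightarrow> g u \<in> {-1, 0, 1}"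
    and h: "\<And>u. u \<in> S \<Longrightarrow> h u \<in> {-1, 0, 1}"
  shows "\<bar>crossing_trace n H (diagonal_in S f) (diagonal_in S g) (diagonal_in S h)\<bar>
      \<le> matrix_w n H ^ 4 * real (card {u \<in> S. f u \<noteq> 0})"
    and "\<bar>crossing_trace n H (diagonal_in S f) (diagonal_in S g) (diagonal_in S h)\<bar>
      \<le> matrix_w n H ^ 4 * real (card {u \<in> S. g u \<noteq> 0})"
    and "\<bar>crossing_trace n H (diagonal_in S f) (diagonal_in S g) (diagonal_in S h)\<bar>
      \<le> matrix_w n H ^ 4 * real (card {u \<in> S. h u \<noteq> 0})"
proof -
  let ?f = "diagonal_in S f" and ?g = "diagonal_in S g" and ?h = "diagonal_in S h"
  have u: "unitary_average ?f" "unitary_average ?g" "unitary_average ?h"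
    using unitary_average_diagonal_in[OF S f] unitary_average_diagonal_in[OF S g]
      unitary_average_diagonal_in[OF S h] by auto
  note cyc = trace_crossing_cyclic[of n H]
  have 1: "crossing_trace n H ?f ?g ?h = Re (trace (crossing n H ?g ?h (mat 1) ** ?f))"
    by (simp only: crossing_trace_def cyc[of "mat 1" ?f ?g ?h] cyc[of ?f ?g ?h "mat 1"])
  have 2: "crossing_trace n H ?f ?g ?h = Re (trace (crossing n H ?h (mat 1) ?f ** ?g))"
    by (simp only: 1 cyc[of ?g ?h "mat 1" ?f])
  show "\<bar>crossing_trace n H ?f ?g ?h\<bar> \<le> matrix_w n H ^ 4 * real (card {u \<in> S. f u \<noteq> 0})"
    unfolding 1 by (intro abs_trace_crossing_diagonal_le S u unitary_average_one f)
  show "\<bar>crossing_trace n H ?f ?g ?h\<bar> \<le> matrix_w n H ^ 4 * real (card {u \<in> S. g u \<noteq> 0})"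
    unfolding 2 by (intro abs_trace_crossing_diagonal_le S u unitary_average_one g)
  show "\<bar>crossing_trace n H ?f ?g ?h\<bar> \<le> matrix_w n H ^ 4 * real (card {u \<in> S. h u \<noteq> 0})"
    unfolding crossing_trace_def by (intro abs_trace_crossing_diagonal_le S u unitary_average_one h)
qed

text \<open>The weights are the successive increments of \<open>f\<close> along the sorted set
  \<open>T\<close>. The least point carries the value of \<open>f\<close> itself, whence the
  nonnegativity assumption.\<close>

lemma monotone_layers:
  fixes f :: "real \<Rightarrow> real"
  assumes "finite T" "\<And>x y. x \<in> T \<Longrightarrow> y \<in> T \<Longrightarrow> x \<le> y \<Longrightarrow> f x \<le> f y" "\<And>x. x \<in> T \<Longrightarrow> 0 \<le> f x"
  obtains a where "\<And>t. t \<in> T \<Longrightarrow> 0 \<le> a t" "\<And>x. x \<in> T \<Longrightarrow> f x = (\<Sum>t\<in>T. a t * (if t \<le> x then 1 else 0))"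
proof -
  have "\<exists>a. (\<forall>t\<in>T. 0 \<le> a t) \<and> (\<forall>x\<in>T. f x = (\<Sum>t\<in>T. a t * (if t \<le> x then 1 else 0)))"
    using assms
  proof (induction T rule: finite_linorder_max_induct)
    case empty
    then show ?case by simp
  next
    case (insert b A)
    have "\<exists>a. (\<forall>t\<in>A. 0 \<le> a t) \<and> (\<forall>x\<in>A. f x = (\<Sum>t\<in>A. a t * (if t \<le> x then 1 else 0)))"
      by (rule insert.IH) (use insert.prems in auto)
    then obtain a where a: "\<And>t. t \<in> A \<Longrightarrow> 0 \<le> a t"
      "\<And>x. x \<in> A \<Longrightarrow> f x = (\<Sum>t\<in>A. a t * (if t \<le> x then 1 else 0))"
      by blast
    have b: "b \<notin> A" using insert.hyps by auto
    define s where "s = (\<Sum>t\<in>A. a t)"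
    have s: "s \<le> f b"
    proof (cases "A = {}")
      case True
      then show ?thesis using insert.prems by (simp add: s_def)
    next
      case False
      have "s = f (Max A)"
        unfolding s_def using a(2)[of "Max A"] insert.hyps(1) False by simp
      also have "\<dots> \<le> f b"
        using insert.prems(1)[of "Max A" b] insert.hyps(1,2) False by force
      finally show ?thesis .
    qed
    \<comment> \<open>\<open>s\<close> has telescoped to the value of \<open>f\<close> at the
      previous maximum, so the new weight is the increment from there.\<close>
    define a' where "a' = a(b := f b - s)"
    have "\<forall>t\<in>insert b A. 0 \<le> a' t"
      using a(1) s b by (auto simp: a'_def)
    moreover have "f x = (\<Sum>t\<in>insert b A. a' t * (if t \<le> x then 1 else 0))" if "x \<in> insert b A" for x
    proof -
      have eq: "(\<Sum>t\<in>A. a' t * (if t \<le> x then 1 else 0)) = (\<Sum>t\<in>A. a t * (if t \<le> x then 1 else 0))"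
        using b by (intro sum.cong) (auto simp: a'_def)
      have eqb: "(\<Sum>t\<in>A. a t * (if t \<le> b then 1 else 0)) = s"
        unfolding s_def using insert.hyps by (intro sum.cong) auto
      show ?thesis
      proof (cases "x = b")
        case True
        then show ?thesis using b insert.hyps(1) eq eqb by (simp add: a'_def)
      next
        case False
        then have "x \<in> A" "x < b" using that insert.hyps by auto
        then show ?thesis using b insert.hyps(1) eq a(2)[of x] by simp
      qed
    qed
    ultimately show ?case by blast
  qed
  with that show ?thesis by blast
qed

lemma crossing_trace_linear:
  "linear (\<lambda>A. crossing_trace n H A B C)" "linear (\<lambda>B. crossing_trace n H A B C)"
  "linear (\<lambda>C. crossing_trace n H A B C)"
proof -
  have r: "linear (\<lambda>Z. Re (trace (Z ** D)))" for D :: "complex^'a^'a"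
    by (rule linearI) (simp_all add: matrix_add_rdistrib matrix_mult_scaleR_left trace_add trace_scaleR)
  show "linear (\<lambda>A. crossing_trace n H A B C)" "linear (\<lambda>B. crossing_trace n H A B C)"
    unfolding crossing_trace_def
    using linear_compose[OF crossing_linear(2) r] linear_compose[OF crossing_linear(3) r] by (auto simp: o_def)
  show "linear (\<lambda>C. crossing_trace n H A B C)"
    unfolding crossing_trace_def
    by (rule linearI) (simp_all add: matrix_add_ldistrib matrix_mult_scaleR_right trace_add trace_scaleR)
qed

text \<open>Layer-cake argument: powers of \<open>\<bar>\<lambda>\<bar>\<close> are positive combinations of indicators of the
  level sets of \<open>\<bar>\<lambda>\<bar>\<close>, and since these are nested, the smallest of three is their intersection.\<close>

theorem crossing_trace_matpow_le:
  fixes H :: "nat \<Rightarrow> complex^'d^'d"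
  assumes X: "hermitian_matrix X" and ev: "even (k + l + m)"
  shows "crossing_trace n H (matpow X k) (matpow X l) (matpow X m)
    \<le> matrix_w n H ^ 4 * Re (trace (matpow X (k + l + m)))"
proof -
  obtain S lam where S: "orthonormal_basis S" and X: "X = diagonal_in S lam"
    using hermitian_diagonalization[OF X] .
  have fin: "finite S" by (rule orthonormal_basis_finite[OF S])
  define W where "W = matrix_w n H ^ 4"
  define T where "T = (\<lambda>u. \<bar>lam u\<bar>) ` S"
  have finT: "finite T" using fin by (simp add: T_def)
  define ind where "ind = (\<lambda>t u. if t \<le> \<bar>lam u\<bar> then 1 else 0 :: real)"
  \<comment> \<open>Only the modulus is layered; the sign rides along as a factor. This keeps the
    entries in {-1, 0, 1} and covers odd exponents.\<close>
  define \<phi> where "\<phi> = (\<lambda>q t u. sgn (lam u) ^ q * ind t u)"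
  have "\<exists>a. (\<forall>t\<in>T. 0 \<le> a t) \<and> (\<forall>u\<in>S. \<bar>lam u\<bar> ^ q = (\<Sum>t\<in>T. a t * ind t u))" for q
  proof -
    have nn: "x \<in> T \<Longrightarrow> 0 \<le> x" for x by (auto simp: T_def)
    obtain a where "\<And>t. t \<in> T \<Longrightarrow> 0 \<le> a t"
      "\<And>x. x \<in> T \<Longrightarrow> x ^ q = (\<Sum>t\<in>T. a t * (if t \<le> x then 1 else 0))"
      using monotone_layers[OF finT, of "\<lambda>x. x ^ q"] nn by (auto intro: power_mono)
    then show ?thesis by (intro exI[of _ a]) (auto simp: T_def ind_def)
  qed
  then obtain a where a: "\<And>q t. t \<in> T \<Longrightarrow> 0 \<le> a q t"
    "\<And>q u. u \<in> S \<Longrightarrow> \<bar>lam u\<bar> ^ q = (\<Sum>t\<in>T. a q t * ind t u)"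
    by metis
  have pow: "matpow X q = (\<Sum>t\<in>T. a q t *\<^sub>R diagonal_in S (\<phi> q t))" for q
  proof -
    have "matpow X q = diagonal_in S (\<lambda>u. \<Sum>t\<in>T. a q t * \<phi> q t u)"
      unfolding X matpow_diagonal_in[OF S]
    proof (rule diagonal_in_cong)
      fix u assume u: "u \<in> S"
      have "lam u ^ q = sgn (lam u) ^ q * \<bar>lam u\<bar> ^ q"
        by (simp add: power_mult_distrib[symmetric] sgn_mult_abs)
      then show "lam u ^ q = (\<Sum>t\<in>T. a q t * \<phi> q t u)"
        by (simp add: a(2)[OF u] \<phi>_def sum_distrib_left mult_ac)
    qed
    then show ?thesis by (simp add: diagonal_in_sum)
  qed
  have val: "\<phi> q t u \<in> {-1, 0, 1}" for q t u
    by (cases "even q"; cases "q = 0") (auto simp: \<phi>_def ind_def sgn_if power_0_left)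
  have le: "crossing_trace n H (diagonal_in S (\<phi> k r)) (diagonal_in S (\<phi> l s)) (diagonal_in S (\<phi> m t))
      \<le> W * (\<Sum>u\<in>S. ind r u * ind s u * ind t u)" (is "?c \<le> _") for r s t
  proof -
    \<comment> \<open>The level set of the largest threshold is the intersection of the three level
      sets, and \<open>z\<close> equals one of \<open>r\<close>, \<open>s\<close>,
      \<open>t\<close>.\<close>
    define z where "z = max r (max s t)"
    have sub: "W * real (card {u \<in> S. \<phi> q z u \<noteq> 0}) \<le> W * (\<Sum>u\<in>S. ind r u * ind s u * ind t u)" for q
    proof -
      have "real (card {u \<in> S. \<phi> q z u \<noteq> 0}) = (\<Sum>u\<in>{u \<in> S. \<phi> q z u \<noteq> 0}. 1)" by simp
      also have "\<dots> \<le> (\<Sum>u\<in>{u \<in> S. \<phi> q z u \<noteq> 0}. ind r u * ind s u * ind t u)"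
        by (intro sum_mono) (auto simp: \<phi>_def ind_def z_def split: if_splits)
      also have "\<dots> \<le> (\<Sum>u\<in>S. ind r u * ind s u * ind t u)"
        using fin by (intro sum_mono2) (auto simp: ind_def)
      finally show ?thesis by (intro mult_left_mono) (auto simp: W_def)
    qed
    consider "z = r" | "z = s" | "z = t" unfolding z_def max_def by metis
    then have "\<bar>?c\<bar> \<le> W * (\<Sum>u\<in>S. ind r u * ind s u * ind t u)"
    proof cases
      case 1
      show ?thesis
        by (rule order_trans[OF abs_crossing_trace_diagonal_le(1)[OF S val[of k r] val[of l s] val[of m t],
            of n H, folded W_def] sub[of k, unfolded 1]])
    next
      case 2
      show ?thesis
        by (rule order_trans[OF abs_crossing_trace_diagonal_le(2)[OF S val[of k r] val[of l s] val[of m t],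
            of n H, folded W_def] sub[of l, unfolded 2]])
    next
      case 3
      show ?thesis
        by (rule order_trans[OF abs_crossing_trace_diagonal_le(3)[OF S val[of k r] val[of l s] val[of m t],
            of n H, folded W_def] sub[of m, unfolded 3]])
    qed
    then show ?thesis by simp
  qed
  note lin = crossing_trace_linear[where n=n and H=H]
  have "crossing_trace n H (matpow X k) (matpow X l) (matpow X m) =
     (\<Sum>r\<in>T. \<Sum>s\<in>T. \<Sum>t\<in>T. a k r * a l s * a m t *
        crossing_trace n H (diagonal_in S (\<phi> k r)) (diagonal_in S (\<phi> l s)) (diagonal_in S (\<phi> m t)))"
    unfolding pow linear_sum[OF lin(1)] linear_scale[OF lin(1)]
    unfolding linear_sum[OF lin(2)] linear_scale[OF lin(2)]
    unfolding linear_sum[OF lin(3)] linear_scale[OF lin(3)]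
    by (simp add: sum_distrib_left mult_ac)
  also have "\<dots> \<le> (\<Sum>r\<in>T. \<Sum>s\<in>T. \<Sum>t\<in>T. a k r * a l s * a m t * (W * (\<Sum>u\<in>S. ind r u * ind s u * ind t u)))"
    by (intro sum_mono mult_left_mono le mult_nonneg_nonneg a(1))
  \<comment> \<open>Resumming the layers separately over r, s and t turns the indicators back into
    powers of the moduli; the even total exponent finally removes the absolute values.\<close>
  also have "\<dots> = W * (\<Sum>r\<in>T. \<Sum>s\<in>T. \<Sum>t\<in>T. \<Sum>u\<in>S. (a k r * ind r u) * (a l s * ind s u) * (a m t * ind t u))"
    by (simp add: sum_distrib_left mult_ac)
  also have "(\<Sum>r\<in>T. \<Sum>s\<in>T. \<Sum>t\<in>T. \<Sum>u\<in>S. (a k r * ind r u) * (a l s * ind s u) * (a m t * ind t u))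
      = (\<Sum>u\<in>S. \<Sum>r\<in>T. \<Sum>s\<in>T. \<Sum>t\<in>T. (a k r * ind r u) * (a l s * ind s u) * (a m t * ind t u))"
    by (simp only: sum.swap[of _ T S])
  also have "\<dots> = (\<Sum>u\<in>S. \<bar>lam u\<bar> ^ k * \<bar>lam u\<bar> ^ l * \<bar>lam u\<bar> ^ m)"
    by (intro sum.cong refl) (simp add: a(2) sum_distrib_left[symmetric] sum_distrib_right[symmetric])
  also have "\<dots> = Re (trace (matpow X (k + l + m)))"
    using ev by (simp add: X matpow_diagonal_in[OF S] trace_diagonal_in[OF S] power_add[symmetric] power_even_abs
        del: of_real_sum)
  finally show ?thesis by (simp add: W_def)
qed

section \<open>Gaussian integration by parts\<close>

text \<open>Integration by parts for a monomial in one variable, read off from the closed form of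
  the moments. At \<open>k = 0\<close> the truncated \<open>k - 1\<close> is masked by the factor
  0.\<close>

lemma std_normal_moment_Suc:
  "(\<integral>x. std_normal_density x * x ^ Suc k \<partial>lborel) = real k * (\<integral>x. std_normal_density x * x ^ (k - 1) \<partial>lborel)"
proof (cases "even k")
  case True
  then obtain m where m: "k = 2 * m" by (auto elim: evenE)
  show ?thesis
  proof (cases m)
    case 0
    then show ?thesis using integral_std_normal_moment_odd[of 0] m by simp
  next
    case (Suc r)
    then have "k - 1 = 2 * r + 1" using m by simp
    then show ?thesis using integral_std_normal_moment_odd[of r] integral_std_normal_moment_odd[of m] m by simp
  qed
next
  case False
  then obtain m where m: "k = 2 * m + 1" by (auto elim: oddE)
  have "(\<integral>x. std_normal_density x * x ^ Suc k \<partial>lborel) = fact (2 * Suc m) / (2 ^ Suc m * fact (Suc m))"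
    using integral_std_normal_moment_even[of "Suc m"] m by simp
  also have "(fact (2 * Suc m) :: real) = (2 * real (Suc m)) * (real k * fact (2 * m))"
    by (simp add: m algebra_simps)
  also have "(2 * real (Suc m)) * (real k * fact (2 * m)) / (2 ^ Suc m * fact (Suc m)) = real k * (fact (2 * m) / (2 ^ m * fact m))"
    by (simp del: of_nat_Suc)
  finally show ?thesis using integral_std_normal_moment_even[of m] m by simp
qed

locale gaussian_family = prob_space M for M :: "'a measure" +
  fixes \<gamma> :: "nat \<Rightarrow> 'a \<Rightarrow> real" and n :: nat
  assumes indep: "indep_vars (\<lambda>_. borel) \<gamma> {1..n}"
    and gauss: "\<And>i. i \<in> {1..n} \<Longrightarrow> distributed M lborel (\<gamma> i) std_normal_density"
begin

lemma moment_integrable: "i \<in> {1..n} \<Longrightarrow> integrable M (\<lambda>\<omega>. \<gamma> i \<omega> ^ k)"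
  using distributed_integrable[OF gauss[of i], of "\<lambda>x. x ^ k"] integrable_std_normal_moment[of k] by simp

lemma moment_Suc:
  assumes "i \<in> {1..n}"
  shows "expectation (\<lambda>\<omega>. \<gamma> i \<omega> ^ Suc k) = real k * expectation (\<lambda>\<omega>. \<gamma> i \<omega> ^ (k - 1))"
  using distributed_integral[OF gauss[OF assms], of "\<lambda>x. x ^ Suc k"]
    distributed_integral[OF gauss[OF assms], of "\<lambda>x. x ^ (k - 1)"] std_normal_moment_Suc[of k] by simp

definition mon :: "(nat \<Rightarrow> nat) \<Rightarrow> 'a \<Rightarrow> real" where
  "mon a \<omega> = (\<Prod>i\<in>{1..n}. \<gamma> i \<omega> ^ a i)"

lemma mon_indep: "indep_vars (\<lambda>_. borel) (\<lambda>i \<omega>. \<gamma> i \<omega> ^ a i) {1..n}"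
  by (rule indep_vars_compose2[OF indep]) simp

lemma integrable_mon: "integrable M (mon a)"
  unfolding mon_def by (intro indep_vars_integrable mon_indep moment_integrable) auto

lemma expectation_mon: "expectation (mon a) = (\<Prod>i\<in>{1..n}. expectation (\<lambda>\<omega>. \<gamma> i \<omega> ^ a i))"
  unfolding mon_def by (intro indep_vars_lebesgue_integral mon_indep moment_integrable) auto

lemma mon_zero: "mon (\<lambda>_. 0) = (\<lambda>_. 1)"
  by (simp add: mon_def fun_eq_iff)

lemma mon_Suc: "i \<in> {1..n} \<Longrightarrow> mon (a(i := Suc (a i))) \<omega> = \<gamma> i \<omega> * mon a \<omega>"
  unfolding mon_def by (subst (1 2) prod.remove[of "{1..n}" i]) (auto intro!: prod.cong)

lemma expectation_mon_Suc:
  assumes "j \<in> {1..n}"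
  shows "expectation (mon (a(j := Suc (a j)))) = real (a j) * expectation (mon (a(j := a j - 1)))"
proof -
  have "expectation (mon (a(j := b))) =
      expectation (\<lambda>\<omega>. \<gamma> j \<omega> ^ b) * (\<Prod>i\<in>{1..n} - {j}. expectation (\<lambda>\<omega>. \<gamma> i \<omega> ^ a i))" for b
    unfolding expectation_mon by (subst prod.remove[OF _ assms]) (auto intro!: prod.cong)
  then show ?thesis using moment_Suc[OF assms] by simp
qed

text \<open>Gaussian integration by parts against all monomials at once, with \<open>D j\<close> in the role of the
  partial derivative of \<open>f\<close> in direction \<open>j\<close>: unlike the plain identity
  \<open>E (\<gamma> j * f) = E (D j)\<close>, this is preserved by multiplication with a coordinate.\<close>

definition stein :: "('a \<Rightarrow> complex^'d^'d) \<Rightarrow> (nat \<Rightarrow> 'a \<Rightarrow> complex^'d^'d) \<Rightarrow> bool" where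
  "stein f D \<longleftrightarrow> (\<forall>a. integrable M (\<lambda>\<omega>. mon a \<omega> *\<^sub>R f \<omega>)) \<and>
    (\<forall>j\<in>{1..n}. \<forall>a. integrable M (\<lambda>\<omega>. mon a \<omega> *\<^sub>R D j \<omega>) \<and>
      (\<integral>\<omega>. mon (a(j := Suc (a j))) \<omega> *\<^sub>R f \<omega> \<partial>M) =
      real (a j) *\<^sub>R (\<integral>\<omega>. mon (a(j := a j - 1)) \<omega> *\<^sub>R f \<omega> \<partial>M) + (\<integral>\<omega>. mon a \<omega> *\<^sub>R D j \<omega> \<partial>M))"

lemma steinD:
  assumes "stein f D"
  shows "integrable M (\<lambda>\<omega>. mon a \<omega> *\<^sub>R f \<omega>)"
    and "j \<in> {1..n} \<Longrightarrow> integrable M (\<lambda>\<omega>. mon a \<omega> *\<^sub>R D j \<omega>)"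
    and "j \<in> {1..n} \<Longrightarrow> (\<integral>\<omega>. mon (a(j := Suc (a j))) \<omega> *\<^sub>R f \<omega> \<partial>M) =
      real (a j) *\<^sub>R (\<integral>\<omega>. mon (a(j := a j - 1)) \<omega> *\<^sub>R f \<omega> \<partial>M) + (\<integral>\<omega>. mon a \<omega> *\<^sub>R D j \<omega> \<partial>M)"
  using assms unfolding stein_def by blast+

lemma stein_cong:
  "stein f D \<Longrightarrow> (\<And>\<omega>. f \<omega> = f' \<omega>) \<Longrightarrow> (\<And>j \<omega>. j \<in> {1..n} \<Longrightarrow> D j \<omega> = D' j \<omega>) \<Longrightarrow> stein f' D'"
  unfolding stein_def by simp

lemma stein_const: "stein (\<lambda>_. A) (\<lambda>_ _. 0)"
  unfolding stein_def using integrable_mon expectation_mon_Suc by simp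

lemma stein_bounded_linear:
  assumes "stein f D" "bounded_linear L"
  shows "stein (\<lambda>\<omega>. L (f \<omega>)) (\<lambda>j \<omega>. L (D j \<omega>))"
proof -
  have L: "r *\<^sub>R L A = L (r *\<^sub>R A)" for r A
    using linear_scale[OF bounded_linear.linear[OF assms(2)]] by simp
  note int = integrable_bounded_linear[OF assms(2)] integral_bounded_linear[OF assms(2)]
  show ?thesis
    unfolding stein_def L
    using steinD[OF assms(1)] linear_add[OF bounded_linear.linear[OF assms(2)]]
    by (auto simp: int L)
qed

lemma stein_add:
  assumes "stein f D" "stein g E"
  shows "stein (\<lambda>\<omega>. f \<omega> + g \<omega>) (\<lambda>j \<omega>. D j \<omega> + E j \<omega>)"
  unfolding stein_def scaleR_add_right
  using steinD[OF assms(1)] steinD[OF assms(2)] by (auto simp: algebra_simps)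

lemma stein_sum:
  assumes "finite I" "\<And>i. i \<in> I \<Longrightarrow> stein (f i) (D i)"
  shows "stein (\<lambda>\<omega>. \<Sum>i\<in>I. f i \<omega>) (\<lambda>j \<omega>. \<Sum>i\<in>I. D i j \<omega>)"
  using assms by (induction I rule: finite_induct) (simp_all add: stein_const stein_add)

text \<open>Leibniz rule for a coordinate: \<open>\<gamma> i\<close> times a monomial is again a
  monomial, so the assumption on \<open>f\<close> applies with the exponent of \<open>i\<close>
  raised by one.\<close>

lemma stein_var:
  assumes f: "stein f D" and i: "i \<in> {1..n}"
  shows "stein (\<lambda>\<omega>. \<gamma> i \<omega> *\<^sub>R f \<omega>) (\<lambda>j \<omega>. (if i = j then f \<omega> else 0) + \<gamma> i \<omega> *\<^sub>R D j \<omega>)"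
proof -
  have m: "mon a \<omega> *\<^sub>R \<gamma> i \<omega> *\<^sub>R A = mon (a(i := Suc (a i))) \<omega> *\<^sub>R A" for a \<omega> and A :: "complex^'d^'d"
    using mon_Suc[OF i] by (simp add: mult.commute)
  have int: "integrable M (\<lambda>\<omega>. mon a \<omega> *\<^sub>R \<gamma> i \<omega> *\<^sub>R f \<omega>)" for a
    unfolding m by (rule steinD(1)[OF f])
  have int2: "integrable M (\<lambda>\<omega>. mon a \<omega> *\<^sub>R \<gamma> i \<omega> *\<^sub>R D j \<omega>)" if "j \<in> {1..n}" for a j
    unfolding m by (rule steinD(2)[OF f that])
  have int3: "integrable M (\<lambda>\<omega>. mon a \<omega> *\<^sub>R (if i = j then f \<omega> else 0))" for a j
    using steinD(1)[OF f] by (cases "i = j") auto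
  have eq: "(\<integral>\<omega>. mon (a(j := Suc (a j))) \<omega> *\<^sub>R \<gamma> i \<omega> *\<^sub>R f \<omega> \<partial>M) =
      real (a j) *\<^sub>R (\<integral>\<omega>. mon (a(j := a j - 1)) \<omega> *\<^sub>R \<gamma> i \<omega> *\<^sub>R f \<omega> \<partial>M)
      + ((\<integral>\<omega>. mon a \<omega> *\<^sub>R (if i = j then f \<omega> else 0) \<partial>M) + (\<integral>\<omega>. mon a \<omega> *\<^sub>R \<gamma> i \<omega> *\<^sub>R D j \<omega> \<partial>M))"
    if j: "j \<in> {1..n}" for a j
  proof (cases "i = j")
    case True
    \<comment> \<open>The raised exponent contributes the factor \<open>a j + 1\<close>; its
      \<open>a j\<close> part is this term and the extra 1 is the new summand \<open>f\<close>. If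
      \<open>a j = 0\<close>, truncated subtraction breaks \<open>Suc (a j - 1) = a j\<close>, but
      the coefficient vanishes.\<close>
    have e: "real (a j) *\<^sub>R (\<integral>\<omega>. mon (a(j := Suc (a j - Suc 0))) \<omega> *\<^sub>R f \<omega> \<partial>M) = real (a j) *\<^sub>R (\<integral>\<omega>. mon a \<omega> *\<^sub>R f \<omega> \<partial>M)"
      by (cases "a j") (auto simp: fun_upd_idem)
    show ?thesis
      unfolding m using steinD(3)[OF f j, of "a(j := Suc (a j))"] True
      by (simp add: scaleR_left_distrib e del: scaleR_cancel_left)
  next
    case False
    then have "a(j := x, i := Suc ((a(j := x)) i)) = (a(i := Suc (a i)))(j := x)" for x
      by (simp add: fun_upd_twist)
    then show ?thesis
      unfolding m using steinD(3)[OF f j, of "a(i := Suc (a i))"] False by simp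
  qed
  show ?thesis
    unfolding stein_def scaleR_add_right
    using int int2 int3 by (auto simp del: scaleR_scaleR simp: eq)
qed

text \<open>Quantifying over all left factors \<open>f\<close> turns the product rule into two
  successive right multiplications. The choice \<open>f = mat 1\<close> recovers integration by
  parts for \<open>g\<close> itself.\<close>

definition stein_derivation :: "('a \<Rightarrow> complex^'d^'d) \<Rightarrow> (nat \<Rightarrow> 'a \<Rightarrow> complex^'d^'d) \<Rightarrow> bool" where
  "stein_derivation g E \<longleftrightarrow> (\<forall>f D. stein f D \<longrightarrow>
    stein (\<lambda>\<omega>. f \<omega> ** g \<omega>) (\<lambda>j \<omega>. D j \<omega> ** g \<omega> + f \<omega> ** E j \<omega>))"

lemma bounded_linear_matrix_mult_right: "bounded_linear (\<lambda>A :: complex^'d^'d. A ** B)"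
  by (intro linear_conv_bounded_linear[THEN iffD1] linearI)
     (simp_all add: matrix_add_rdistrib matrix_mult_scaleR_left)

lemma stein_derivation_const: "stein_derivation (\<lambda>_. B) (\<lambda>_ _. 0)"
  unfolding stein_derivation_def
  by (auto intro!: stein_bounded_linear[OF _ bounded_linear_matrix_mult_right])

lemma stein_derivation_mult:
  fixes g h :: "'a \<Rightarrow> complex^'d^'d"
  assumes "stein_derivation g E" "stein_derivation h F"
  shows "stein_derivation (\<lambda>\<omega>. g \<omega> ** h \<omega>) (\<lambda>j \<omega>. E j \<omega> ** h \<omega> + g \<omega> ** F j \<omega>)"
  unfolding stein_derivation_def
proof (intro allI impI)
  fix f :: "'a \<Rightarrow> complex^'d^'d" and D assume "stein f D"
  then have "stein (\<lambda>\<omega>. f \<omega> ** g \<omega>) (\<lambda>j \<omega>. D j \<omega> ** g \<omega> + f \<omega> ** E j \<omega>)"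
    using assms(1) unfolding stein_derivation_def by blast
  then have "stein (\<lambda>\<omega>. (f \<omega> ** g \<omega>) ** h \<omega>)
     (\<lambda>j \<omega>. (D j \<omega> ** g \<omega> + f \<omega> ** E j \<omega>) ** h \<omega> + (f \<omega> ** g \<omega>) ** F j \<omega>)"
    using assms(2) unfolding stein_derivation_def by blast
  then show "stein (\<lambda>\<omega>. f \<omega> ** (g \<omega> ** h \<omega>))
     (\<lambda>j \<omega>. D j \<omega> ** (g \<omega> ** h \<omega>) + f \<omega> ** (E j \<omega> ** h \<omega> + g \<omega> ** F j \<omega>))"
    by (simp add: matrix_add_ldistrib matrix_add_rdistrib matrix_mul_assoc add.assoc)
qed

lemma stein_derivation_gauss_series:
  fixes H :: "nat \<Rightarrow> complex^'d^'d"
  shows "stein_derivation (gauss_series n H \<gamma>) (\<lambda>j _. H j)"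
  unfolding stein_derivation_def
proof (intro allI impI)
  fix f :: "'a \<Rightarrow> complex^'d^'d" and D assume f: "stein f D"
  have "stein (\<lambda>\<omega>. \<Sum>i\<in>{1..n}. \<gamma> i \<omega> *\<^sub>R (f \<omega> ** H i))
    (\<lambda>j \<omega>. \<Sum>i\<in>{1..n}. (if i = j then f \<omega> ** H i else 0) + \<gamma> i \<omega> *\<^sub>R (D j \<omega> ** H i))"
    by (intro stein_sum stein_var stein_bounded_linear[OF f bounded_linear_matrix_mult_right]) auto
  then show "stein (\<lambda>\<omega>. f \<omega> ** gauss_series n H \<gamma> \<omega>) (\<lambda>j \<omega>. D j \<omega> ** gauss_series n H \<gamma> \<omega> + f \<omega> ** H j)"
    by (rule stein_cong)
       (simp_all add: gauss_series_def matrix_mult_sum_right matrix_mult_scaleR_right sum.distrib)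
qed

lemma stein_derivation_matpow:
  assumes "stein_derivation g E"
  shows "stein_derivation (\<lambda>\<omega>. matpow (g \<omega>) k)
    (\<lambda>j \<omega>. \<Sum>l<k. matpow (g \<omega>) l ** E j \<omega> ** matpow (g \<omega>) (k - 1 - l))"
proof (induction k)
  case 0
  then show ?case using stein_derivation_const by simp
next
  case (Suc k)
  have "(\<Sum>l<Suc k. matpow (g \<omega>) l ** E j \<omega> ** matpow (g \<omega>) (Suc k - 1 - l)) =
     E j \<omega> ** matpow (g \<omega>) k + g \<omega> ** (\<Sum>l<k. matpow (g \<omega>) l ** E j \<omega> ** matpow (g \<omega>) (k - 1 - l))" for j \<omega>
    unfolding sum.lessThan_Suc_shift by (simp add: matrix_mult_sum_right matrix_mul_assoc)
  then show ?case using stein_derivation_mult[OF assms Suc] by simp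
qed

lemma stein_derivation_integrable:
  assumes "stein_derivation g E"
  shows "integrable M g" "j \<in> {1..n} \<Longrightarrow> integrable M (E j)"
    and "j \<in> {1..n} \<Longrightarrow> integrable M (\<lambda>\<omega>. \<gamma> j \<omega> *\<^sub>R g \<omega>)"
    and "j \<in> {1..n} \<Longrightarrow> (\<integral>\<omega>. \<gamma> j \<omega> *\<^sub>R g \<omega> \<partial>M) = (\<integral>\<omega>. E j \<omega> \<partial>M)"
proof -
  have s: "stein g E"
    using assms stein_const[of "mat 1"] unfolding stein_derivation_def by fastforce
  show "integrable M g" using steinD(1)[OF s, of "\<lambda>_. 0"] by (simp add: mon_zero)
  show "integrable M (E j)" if "j \<in> {1..n}" using steinD(2)[OF s that, of "\<lambda>_. 0"] by (simp add: mon_zero)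
  have m: "mon ((\<lambda>_. 0)(j := Suc 0)) = \<gamma> j" if "j \<in> {1..n}" for j
    using mon_Suc[OF that, of "\<lambda>_. 0"] by (simp add: mon_zero fun_eq_iff)
  show "integrable M (\<lambda>\<omega>. \<gamma> j \<omega> *\<^sub>R g \<omega>)" if "j \<in> {1..n}"
    using steinD(1)[OF s, of "(\<lambda>_. 0)(j := Suc 0)"] by (simp add: m[OF that])
  show "(\<integral>\<omega>. \<gamma> j \<omega> *\<^sub>R g \<omega> \<partial>M) = (\<integral>\<omega>. E j \<omega> \<partial>M)" if "j \<in> {1..n}"
    using steinD(3)[OF s that, of "\<lambda>_. 0"] by (simp add: m[OF that] mon_zero)
qed

lemma bounded_linear_Re_trace: "bounded_linear (\<lambda>A :: complex^'d^'d. Re (trace A))"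
  by (intro linear_conv_bounded_linear[THEN iffD1] linearI) (simp_all add: trace_add trace_scaleR)

lemma stein_derivation_trace:
  assumes "stein_derivation g E"
  shows "integrable M (\<lambda>\<omega>. Re (trace (g \<omega>)))" "j \<in> {1..n} \<Longrightarrow> integrable M (\<lambda>\<omega>. Re (trace (E j \<omega>)))"
    and "j \<in> {1..n} \<Longrightarrow> integrable M (\<lambda>\<omega>. \<gamma> j \<omega> * Re (trace (g \<omega>)))"
    and "j \<in> {1..n} \<Longrightarrow> expectation (\<lambda>\<omega>. \<gamma> j \<omega> * Re (trace (g \<omega>))) = expectation (\<lambda>\<omega>. Re (trace (E j \<omega>)))"
proof -
  note s = stein_derivation_integrable[OF assms]
  note L = integrable_bounded_linear[OF bounded_linear_Re_trace]
  have e: "\<gamma> j \<omega> * Re (trace (g \<omega>)) = Re (trace (\<gamma> j \<omega> *\<^sub>R g \<omega>))" for j \<omega>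
    by (simp add: trace_scaleR)
  show "integrable M (\<lambda>\<omega>. Re (trace (g \<omega>)))" by (rule L[OF s(1)])
  show "integrable M (\<lambda>\<omega>. Re (trace (E j \<omega>)))" if "j \<in> {1..n}" by (rule L[OF s(2)[OF that]])
  show "integrable M (\<lambda>\<omega>. \<gamma> j \<omega> * Re (trace (g \<omega>)))" if "j \<in> {1..n}"
    unfolding e by (rule L[OF s(3)[OF that]])
  show "expectation (\<lambda>\<omega>. \<gamma> j \<omega> * Re (trace (g \<omega>))) = expectation (\<lambda>\<omega>. Re (trace (E j \<omega>)))" if "j \<in> {1..n}"
    unfolding e integral_bounded_linear[OF bounded_linear_Re_trace s(3)[OF that]] s(4)[OF that]
    by (rule integral_bounded_linear[OF bounded_linear_Re_trace s(2)[OF that], symmetric])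
qed

end

section \<open>Moments of a matrix Gaussian series\<close>

lemma matrix_w_nonneg: "0 \<le> matrix_w n H"
  using matrix_w_max[of n H] by (auto simp: alignment_term_def spectral_norm_nonneg)

text \<open>Young's inequality without roots: the convex function t^(q+1) at \<open>y\<close> lies
  above its tangent at \<open>x\<close>.\<close>

lemma weighted_am_gm_Suc:
  fixes x y :: real
  assumes "0 \<le> x" "0 \<le> y"
  shows "real (Suc q) * x ^ q * y \<le> real q * x ^ Suc q + y ^ Suc q"
proof (induction q)
  case 0
  then show ?case by simp
next
  case (Suc q)
  have "0 \<le> (x ^ Suc q - y ^ Suc q) * (x - y)"
  proof (cases "x \<le> y")
    case True
    then have "x ^ Suc q \<le> y ^ Suc q" using assms by (intro power_mono)
    then show ?thesis using True by (intro mult_nonpos_nonpos) auto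
  next
    case False
    then have "y ^ Suc q \<le> x ^ Suc q" using assms by (intro power_mono) auto
    then show ?thesis using False by (intro mult_nonneg_nonneg) auto
  qed
  then have "x * y ^ Suc q + x ^ Suc q * y \<le> x ^ Suc (Suc q) + y ^ Suc (Suc q)"
    by (simp add: algebra_simps)
  moreover have "x * (real (Suc q) * x ^ q * y) \<le> x * (real q * x ^ Suc q + y ^ Suc q)"
    using Suc assms by (intro mult_left_mono) auto
  ultimately show ?case by (simp add: algebra_simps)
qed

text \<open>Young's inequality at each squared eigenvalue. Being linear in the traces it passes to
  expectations, where it compares consecutive even moments in place of Hoelder's inequality.\<close>

lemma trace_matpow_young:
  fixes X :: "complex^'d^'d"
  assumes "hermitian_matrix X" "0 \<le> y"
  shows "real (Suc q) * y * Re (trace (matpow X (2 * q)))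
    \<le> real q * Re (trace (matpow X (2 * Suc q))) + real CARD('d) * y ^ Suc q"
proof -
  obtain S f where S: "orthonormal_basis S" and X: "X = diagonal_in S f"
    using hermitian_diagonalization[OF assms(1)] .
  have tr: "Re (trace (matpow X (2 * k))) = (\<Sum>u\<in>S. ((f u)\<^sup>2) ^ k)" for k
    by (simp add: X matpow_diagonal_in[OF S] trace_diagonal_in[OF S] power_mult del: of_real_sum)
  have "real (Suc q) * y * Re (trace (matpow X (2 * q))) = (\<Sum>u\<in>S. real (Suc q) * ((f u)\<^sup>2) ^ q * y)"
    unfolding tr sum_distrib_left by (simp add: mult_ac)
  also have "\<dots> \<le> (\<Sum>u\<in>S. real q * ((f u)\<^sup>2) ^ Suc q + y ^ Suc q)"
    by (intro sum_mono weighted_am_gm_Suc assms) simp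
  also have "\<dots> = real q * Re (trace (matpow X (2 * Suc q))) + real CARD('d) * y ^ Suc q"
    unfolding tr sum.distrib sum_distrib_left[symmetric] sum_constant orthonormal_basis_card[OF S] ..
  finally show ?thesis .
qed

lemma trace_matpow_nonneg:
  assumes "hermitian_matrix X" "even k"
  shows "0 \<le> Re (trace (matpow X k))"
  using spectral_norm_power_le_trace[OF assms] zero_le_power[OF spectral_norm_nonneg[of X], of k] by linarith

lemma hermitian_sum_square:
  assumes "\<And>i. i \<in> {1..n} \<Longrightarrow> hermitian_matrix (H i)"
  shows "u \<bullet> ((\<Sum>i=1..n. H i ** H i) *v u) = (\<Sum>i=1..n. (norm (H i *v u))\<^sup>2)"
proof -
  have "u \<bullet> (H i *v (H i *v u)) = (norm (H i *v u))\<^sup>2" if "i \<in> {1..n}" for i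
    using cinner_hermitian[OF assms[OF that], of u "H i *v u"] by (metis Re_cinner power2_norm_eq_inner)
  then show ?thesis
    by (simp add: matrix_vector_mult_sum_left inner_sum_right matrix_vector_mul_assoc[symmetric])
qed

text \<open>Shifting the outer \<open>H i\<close> onto \<open>u\<close>, the inner \<open>V\<close>
  costs one factor of its norm, and the remaining sum of |H_i u|^2 is
  \<open>u \<bullet> (V *v u)\<close>, which costs the other.\<close>

lemma trace_nested_square_le:
  fixes H :: "nat \<Rightarrow> complex^'d^'d"
  assumes H: "\<And>i. i \<in> {1..n} \<Longrightarrow> hermitian_matrix (H i)" and "norm u = 1"
  defines "V \<equiv> (\<Sum>i=1..n. H i ** H i)"
  shows "u \<bullet> ((\<Sum>i=1..n. H i ** V ** H i) *v u) \<le> (spectral_norm V)\<^sup>2"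
proof -
  have "u \<bullet> ((\<Sum>i=1..n. H i ** V ** H i) *v u) = (\<Sum>i=1..n. u \<bullet> (H i *v (V *v (H i *v u))))"
    by (simp add: matrix_vector_mult_sum_left inner_sum_right matrix_vector_mul_assoc[symmetric])
  also have "\<dots> = (\<Sum>i=1..n. (H i *v u) \<bullet> (V *v (H i *v u)))"
    using cinner_hermitian[OF H] by (intro sum.cong refl) (metis Re_cinner)
  also have "\<dots> \<le> (\<Sum>i=1..n. spectral_norm V * (norm (H i *v u))\<^sup>2)"
    using abs_inner_le_spectral_norm[of _ V] by (intro sum_mono) (meson abs_le_D1)
  also have "\<dots> = spectral_norm V * (u \<bullet> (V *v u))"
  proof -
    have "u \<bullet> (V *v u) = (\<Sum>i=1..n. (norm (H i *v u))\<^sup>2)"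
      unfolding V_def by (rule hermitian_sum_square) (rule H)
    then show ?thesis by (simp only: sum_distrib_left)
  qed
  also have "\<dots> \<le> spectral_norm V * spectral_norm V"
    using abs_inner_le_spectral_norm[of u V] assms(2) by (intro mult_left_mono) (auto simp: spectral_norm_nonneg)
  finally show ?thesis by (simp add: power2_eq_square)
qed

section \<open>Recursion for the trace moments of the random matrix\<close>

locale hermitian_gauss_series = gaussian_family M \<gamma> n
  for M :: "'a measure" and \<gamma> n +
  fixes H :: "nat \<Rightarrow> complex^'d^'d"
  assumes hermitian: "\<And>i. i \<in> {1..n} \<Longrightarrow> hermitian_matrix (H i)"
begin

definition pow :: "nat \<Rightarrow> 'a \<Rightarrow> complex^'d^'d" where
  "pow k \<omega> = matpow (gauss_series n H \<gamma> \<omega>) k"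

definition V :: "complex^'d^'d" where "V = (\<Sum>i=1..n. H i ** H i)"

definition sandwich :: "nat \<Rightarrow> nat \<Rightarrow> 'a \<Rightarrow> real" where
  "sandwich a b \<omega> = (\<Sum>i=1..n. Re (trace (H i ** pow a \<omega> ** H i ** pow b \<omega>)))"

definition moment :: "nat \<Rightarrow> real" where
  "moment k = expectation (\<lambda>\<omega>. Re (trace (pow k \<omega>)))"

lemma hermitian_X: "hermitian_matrix (gauss_series n H \<gamma> \<omega>)"
proof -
  have "cnj (H i $ a $ b) = H i $ b $ a" if "i \<in> {1..n}" for i a b
    using hermitian[OF that] unfolding hermitian_matrix_def conj_transpose_def vec_eq_iff
    by (metis vec_lambda_beta)
  then show ?thesis
    by (simp add: hermitian_matrix_def gauss_series_def conj_transpose_def vec_eq_iff)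
qed

lemma stein_derivation_pow:
  "stein_derivation (pow k) (\<lambda>j \<omega>. \<Sum>l<k. pow l \<omega> ** H j ** pow (k - 1 - l) \<omega>)"
  unfolding pow_def[abs_def] by (rule stein_derivation_matpow[OF stein_derivation_gauss_series])

lemma stein_derivation_const_mult:
  assumes "stein_derivation g E"
  shows "stein_derivation (\<lambda>\<omega>. B ** g \<omega>) (\<lambda>j \<omega>. B ** E j \<omega>)"
  using stein_derivation_mult[OF stein_derivation_const assms] by simp

lemma integrable_trace_pow: "integrable M (\<lambda>\<omega>. Re (trace (pow k \<omega>)))"
  by (rule stein_derivation_trace(1)[OF stein_derivation_pow])

lemma integrable_sandwich: "integrable M (sandwich a b)"
proof -
  have "integrable M (\<lambda>\<omega>. Re (trace ((H i ** pow a \<omega>) ** (H i ** pow b \<omega>))))" for i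
    by (rule stein_derivation_trace(1)[OF stein_derivation_mult[OF stein_derivation_const_mult[OF stein_derivation_pow]
          stein_derivation_const_mult[OF stein_derivation_pow]]])
  then show ?thesis
    unfolding sandwich_def[abs_def] by (simp add: matrix_mul_assoc)
qed

lemma moment_nonneg: "even k \<Longrightarrow> 0 \<le> moment k"
  unfolding moment_def pow_def by (intro Bochner_Integration.integral_nonneg trace_matpow_nonneg hermitian_X)

lemma moment_Suc: "moment (Suc k) = (\<Sum>l<k. expectation (sandwich l (k - 1 - l)))"
proof -
  note d = stein_derivation_const_mult[OF stein_derivation_pow[of k]]
  have "Re (trace (pow (Suc k) \<omega>)) = (\<Sum>i=1..n. \<gamma> i \<omega> * Re (trace (H i ** pow k \<omega>)))" for \<omega>
    by (simp add: pow_def gauss_series_def matrix_mult_sum_left matrix_mult_scaleR_left trace_sum trace_scaleR)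
  then have "moment (Suc k) = (\<Sum>i=1..n. expectation (\<lambda>\<omega>. \<gamma> i \<omega> * Re (trace (H i ** pow k \<omega>))))"
    unfolding moment_def using stein_derivation_trace(3)[OF d] by simp
  also have "\<dots> = (\<Sum>i=1..n. expectation (\<lambda>\<omega>. Re (trace (H i ** (\<Sum>l<k. pow l \<omega> ** H i ** pow (k - 1 - l) \<omega>)))))"
    by (intro sum.cong refl stein_derivation_trace(4)[OF d])
  also have "\<dots> = expectation (\<lambda>\<omega>. \<Sum>i=1..n. Re (trace (H i ** (\<Sum>l<k. pow l \<omega> ** H i ** pow (k - 1 - l) \<omega>))))"
    using stein_derivation_trace(2)[OF d] by simp
  also have "\<dots> = expectation (\<lambda>\<omega>. \<Sum>l<k. sandwich l (k - 1 - l) \<omega>)"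
    by (simp add: sandwich_def matrix_mult_sum_right trace_sum matrix_mul_assoc sum.swap[of _ "{..<k}"])
  also have "\<dots> = (\<Sum>l<k. expectation (sandwich l (k - 1 - l)))"
    using integrable_sandwich by simp
  finally show ?thesis .
qed

lemma sandwich_le:
  assumes "even m" "even (a + b)" "m \<le> a" "m \<le> b"
  shows "expectation (sandwich a b) \<le> expectation (sandwich m (a + b - m))"
  unfolding sandwich_def pow_def
  by (intro integral_mono integrable_sandwich[unfolded sandwich_def[abs_def] pow_def] sum_mono trace_sandwich_le
      hermitian hermitian_X assms)

lemma sandwich_zero_le:
  assumes "even k"
  shows "expectation (sandwich 0 k) \<le> spectral_norm V * moment k"
proof -
  have "sandwich 0 k \<omega> \<le> spectral_norm V * Re (trace (pow k \<omega>))" for \<omega>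
  proof -
    have "sandwich 0 k \<omega> = Re (trace (V ** pow k \<omega>))"
      by (simp add: sandwich_def V_def pow_def matrix_mult_sum_left trace_sum)
    also have "\<dots> \<le> spectral_norm V * Re (trace (pow k \<omega>))"
      unfolding pow_def using abs_inner_le_spectral_norm[of _ V]
      by (intro trace_mult_matpow_le hermitian_X assms) (metis abs_le_D1 mult.right_neutral power_one)
    finally show ?thesis .
  qed
  then have "expectation (sandwich 0 k) \<le> expectation (\<lambda>\<omega>. spectral_norm V * Re (trace (pow k \<omega>)))"
    by (intro integral_mono integrable_sandwich integrable_mult_right integrable_trace_pow)
  then show ?thesis by (simp add: moment_def)
qed

text \<open>Only one of the two factors of X^2 is expanded in the \<gamma>'s. The derivative of the
  other one gives the nested term with \<open>V\<close>, the derivative of X^b the crossing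
  terms.\<close>

lemma expectation_sandwich_two:
  defines "f \<equiv> (\<lambda>b \<omega>. Re (trace ((\<Sum>i=1..n. H i ** V ** H i) ** pow b \<omega>))
    + (\<Sum>l<b. crossing_trace n H (pow 1 \<omega>) (pow l \<omega>) (pow (b - 1 - l) \<omega>)))"
  shows "expectation (sandwich 2 b) = expectation (f b)" "integrable M (f b)"
proof -
  \<comment> \<open>\<open>g i j\<close> is the word left once \<open>\<gamma> j\<close> is pulled
    out, and \<open>E i j\<close> its derivative in the same direction \<open>j\<close>.\<close>
  define g where "g = (\<lambda>i j \<omega>. H i ** H j ** (pow 1 \<omega> ** (H i ** pow b \<omega>)))"
  define E where "E = (\<lambda>i j \<omega>. H i ** H j ** (H j ** (H i ** pow b \<omega>)
    + pow 1 \<omega> ** (H i ** (\<Sum>l<b. pow l \<omega> ** H j ** pow (b - 1 - l) \<omega>))))"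
  have d: "stein_derivation (g i j) (\<lambda>k \<omega>. H i ** H j ** (H k ** (H i ** pow b \<omega>)
      + pow 1 \<omega> ** (H i ** (\<Sum>l<b. pow l \<omega> ** H k ** pow (b - 1 - l) \<omega>))))" for i j
  proof -
    have "(\<Sum>l<1. pow l \<omega> ** H k ** pow (1 - 1 - l) \<omega>) = H k" for k \<omega>
      by (simp add: pow_def)
    then show ?thesis
      unfolding g_def
      using stein_derivation_const_mult[OF stein_derivation_mult[OF stein_derivation_pow[of 1]
          stein_derivation_const_mult[OF stein_derivation_pow[of b], of "H i"]], of "H i ** H j"] by simp
  qed
  have int: "integrable M (\<lambda>\<omega>. \<gamma> j \<omega> * Re (trace (g i j \<omega>)))" "integrable M (\<lambda>\<omega>. Re (trace (E i j \<omega>)))"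
    and eq: "expectation (\<lambda>\<omega>. \<gamma> j \<omega> * Re (trace (g i j \<omega>))) = expectation (\<lambda>\<omega>. Re (trace (E i j \<omega>)))"
    if "j \<in> {1..n}" for i j
    using stein_derivation_trace(2-4)[OF d that] by (auto simp: E_def)
  have sw: "sandwich 2 b \<omega> = (\<Sum>i=1..n. \<Sum>j=1..n. \<gamma> j \<omega> * Re (trace (g i j \<omega>)))" for \<omega>
  proof -
    have "pow 2 \<omega> = gauss_series n H \<gamma> \<omega> ** pow 1 \<omega>"
      by (simp add: pow_def eval_nat_numeral)
    then show ?thesis
      by (simp add: sandwich_def g_def gauss_series_def matrix_mult_sum_left matrix_mult_sum_right
          matrix_mult_scaleR_left matrix_mult_scaleR_right trace_sum trace_scaleR matrix_mul_assoc)
  qed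
  have fE: "f b \<omega> = (\<Sum>i=1..n. \<Sum>j=1..n. Re (trace (E i j \<omega>)))" for \<omega>
  proof -
    have "(\<Sum>i=1..n. \<Sum>j=1..n. Re (trace (E i j \<omega>))) =
        (\<Sum>i=1..n. \<Sum>j=1..n. Re (trace (H i ** (H j ** H j) ** H i ** pow b \<omega>))) +
        (\<Sum>i=1..n. \<Sum>j=1..n. \<Sum>l<b. Re (trace (H i ** mat 1 ** H j ** pow 1 \<omega> ** H i ** pow l \<omega> ** H j ** pow (b - 1 - l) \<omega>)))"
      by (simp add: E_def matrix_add_ldistrib trace_add sum.distrib matrix_mult_sum_right trace_sum matrix_mul_assoc)
    also have "(\<Sum>i=1..n. \<Sum>j=1..n. Re (trace (H i ** (H j ** H j) ** H i ** pow b \<omega>))) =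
        Re (trace ((\<Sum>i=1..n. H i ** V ** H i) ** pow b \<omega>))"
      by (simp add: V_def matrix_mult_sum_left matrix_mult_sum_right trace_sum)
    also have "(\<Sum>i=1..n. \<Sum>j=1..n. \<Sum>l<b. Re (trace (H i ** mat 1 ** H j ** pow 1 \<omega> ** H i ** pow l \<omega> ** H j ** pow (b - 1 - l) \<omega>)))
       = (\<Sum>l<b. \<Sum>i=1..n. \<Sum>j=1..n. Re (trace (H i ** mat 1 ** H j ** pow 1 \<omega> ** H i ** pow l \<omega> ** H j ** pow (b - 1 - l) \<omega>)))"
      by (simp only: sum.swap[of _ "{1..n}" "{..<b}"])
    also have "\<dots> = (\<Sum>l<b. crossing_trace n H (pow 1 \<omega>) (pow l \<omega>) (pow (b - 1 - l) \<omega>))"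
      by (simp add: crossing_trace_def crossing_def matrix_mult_sum_left trace_sum)
    finally show ?thesis by (simp add: f_def)
  qed
  have double_sum: "expectation (\<lambda>\<omega>. \<Sum>i=1..n. \<Sum>j=1..n. \<phi> i j \<omega>) = (\<Sum>i=1..n. \<Sum>j=1..n. expectation (\<phi> i j))"
    if "\<And>i j. j \<in> {1..n} \<Longrightarrow> integrable M (\<phi> i j)" for \<phi> :: "nat \<Rightarrow> nat \<Rightarrow> 'a \<Rightarrow> real"
  proof -
    have "expectation (\<lambda>\<omega>. \<Sum>i=1..n. \<Sum>j=1..n. \<phi> i j \<omega>) = (\<Sum>i=1..n. expectation (\<lambda>\<omega>. \<Sum>j=1..n. \<phi> i j \<omega>))"
      by (intro Bochner_Integration.integral_sum Bochner_Integration.integrable_sum that)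
    also have "\<dots> = (\<Sum>i=1..n. \<Sum>j=1..n. expectation (\<phi> i j))"
      by (intro sum.cong refl Bochner_Integration.integral_sum that)
    finally show ?thesis .
  qed
  show "integrable M (f b)" unfolding fE[abs_def] by (intro Bochner_Integration.integrable_sum int(2))
  have "expectation (sandwich 2 b) = (\<Sum>i=1..n. \<Sum>j=1..n. expectation (\<lambda>\<omega>. \<gamma> j \<omega> * Re (trace (g i j \<omega>))))"
    unfolding sw[abs_def] by (rule double_sum) (rule int(1))
  also have "\<dots> = (\<Sum>i=1..n. \<Sum>j=1..n. expectation (\<lambda>\<omega>. Re (trace (E i j \<omega>))))"
    using eq by simp
  also have "\<dots> = expectation (f b)"
    unfolding fE[abs_def] by (rule double_sum[symmetric]) (rule int(2))
  finally show "expectation (sandwich 2 b) = expectation (f b)" .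
qed

lemma sandwich_two_le:
  assumes "even b"
  shows "expectation (sandwich 2 b) \<le> ((spectral_norm V)\<^sup>2 + real b * matrix_w n H ^ 4) * moment b"
proof -
  let ?W = "matrix_w n H ^ 4"
  have "expectation (sandwich 2 b) \<le> expectation (\<lambda>\<omega>. ((spectral_norm V)\<^sup>2 + real b * ?W) * Re (trace (pow b \<omega>)))"
    unfolding expectation_sandwich_two(1)
  proof (intro integral_mono expectation_sandwich_two(2) integrable_mult_right integrable_trace_pow)
    fix \<omega>
    have "Re (trace ((\<Sum>i=1..n. H i ** V ** H i) ** pow b \<omega>)) \<le> (spectral_norm V)\<^sup>2 * Re (trace (pow b \<omega>))"
      unfolding pow_def V_def
      by (intro trace_mult_matpow_le hermitian_X assms trace_nested_square_le hermitian)
    moreover have "(\<Sum>l<b. crossing_trace n H (pow 1 \<omega>) (pow l \<omega>) (pow (b - 1 - l) \<omega>))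
        \<le> (\<Sum>l<b. ?W * Re (trace (pow b \<omega>)))"
    proof (rule sum_mono)
      fix l assume "l \<in> {..<b}"
      then have "1 + l + (b - 1 - l) = b" by auto
      then show "crossing_trace n H (pow 1 \<omega>) (pow l \<omega>) (pow (b - 1 - l) \<omega>) \<le> ?W * Re (trace (pow b \<omega>))"
        using crossing_trace_matpow_le[OF hermitian_X[of \<omega>], of 1 l "b - 1 - l" n H] assms unfolding pow_def by simp
    qed
    ultimately show "Re (trace ((\<Sum>i=1..n. H i ** V ** H i) ** pow b \<omega>)) +
        (\<Sum>l<b. crossing_trace n H (pow 1 \<omega>) (pow l \<omega>) (pow (b - 1 - l) \<omega>))
        \<le> ((spectral_norm V)\<^sup>2 + real b * ?W) * Re (trace (pow b \<omega>))"
      by (simp add: algebra_simps)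
  qed
  then show ?thesis by (simp add: moment_def)
qed

text \<open>The shift p = q + 3 encodes p >= 3. Then the exponents 0, 1, 2q+3, 2q+4 are four
  distinct terms, and in the other 2q+1 terms both powers are at least 2.\<close>

lemma moment_second_order:
  "moment (2 * q + 6) \<le> 4 * spectral_norm V * moment (2 * q + 4)
    + real (2 * q + 1) * ((spectral_norm V)\<^sup>2 + real (2 * q + 2) * matrix_w n H ^ 4) * moment (2 * q + 2)"
proof -
  define g where "g l = expectation (sandwich l (2 * q + 4 - l))" for l
  define A where "A = spectral_norm V * moment (2 * q + 4)"
  define B where "B = ((spectral_norm V)\<^sup>2 + real (2 * q + 2) * matrix_w n H ^ 4) * moment (2 * q + 2)"
  have gA: "g l \<le> A" if "l \<le> 2 * q + 4" for l
    using sandwich_le[of 0 l "2 * q + 4 - l"] sandwich_zero_le[of "2 * q + 4"] that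
    by (simp add: g_def A_def)
  have gB: "g (Suc (Suc l)) \<le> B" if "l < 2 * q + 1" for l
  proof -
    have "2 \<le> 2 * q + 2 - l" "l + 2 + (2 * q + 2 - l) = 2 * q + 4" using that by auto
    then show ?thesis
      using sandwich_le[of 2 "l + 2" "2 * q + 2 - l"] sandwich_two_le[of "2 * q + 2"] that
      by (simp add: g_def B_def)
  qed
  have "2 * q + 6 = Suc (2 * q + 5)" "2 * q + 5 - 1 = 2 * q + 4" by simp_all
  then have "moment (2 * q + 6) = (\<Sum>l<2 * q + 5. g l)"
    unfolding g_def by (simp only: moment_Suc)
  also have "2 * q + 5 = Suc (Suc (Suc (Suc (2 * q + 1))))" by simp
  also have "(\<Sum>l<Suc (Suc (Suc (Suc (2 * q + 1)))). g l) =
      g 0 + g 1 + (\<Sum>l<2 * q + 1. g (Suc (Suc l))) + g (2 * q + 3) + g (2 * q + 4)"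
    unfolding sum.lessThan_Suc[of g "Suc (Suc (Suc (2 * q + 1)))"] sum.lessThan_Suc[of g "Suc (Suc (2 * q + 1))"]
      sum.lessThan_Suc_shift[of g] sum.lessThan_Suc_shift[of "\<lambda>n. g (Suc n)"]
    by (simp add: eval_nat_numeral)
  also have "\<dots> \<le> A + A + (\<Sum>l<2 * q + 1. B) + A + A"
    by (intro add_mono sum_mono gA gB) auto
  finally show ?thesis by (simp add: A_def B_def algebra_simps)
qed

text \<open>\<open>rec\<close> places \<open>y\<close> where the characteristic polynomial of the
  recursion is nonnegative. If the bound failed, Young's inequality would give y m4 < m6 and y^2 m2
  < m6, and the recursion would yield y^2 m6 < y^2 m6.\<close>

lemma moment_le:
  assumes y: "0 < y" and rec: "4 * spectral_norm V * y
    + real (2 * q + 1) * ((spectral_norm V)\<^sup>2 + real (2 * q + 2) * matrix_w n H ^ 4) \<le> y\<^sup>2"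
  shows "moment (2 * q + 6) \<le> real CARD('d) * y ^ (q + 3)"
proof (rule ccontr)
  define \<alpha> where "\<alpha> = 4 * spectral_norm V"
  define \<beta> where "\<beta> = y\<^sup>2 - \<alpha> * y"
  define D where "D = real CARD('d) * y ^ (q + 3)"
  define m6 m4 m2 where "m6 = moment (2 * q + 6)" and "m4 = moment (2 * q + 4)" and "m2 = moment (2 * q + 2)"
  have young: "real (Suc k) * y * moment (2 * k) \<le> real k * moment (2 * Suc k) + real CARD('d) * y ^ Suc k" for k
  proof -
    have "expectation (\<lambda>\<omega>. real (Suc k) * y * Re (trace (pow (2 * k) \<omega>)))
        \<le> expectation (\<lambda>\<omega>. real k * Re (trace (pow (2 * Suc k) \<omega>)) + real CARD('d) * y ^ Suc k)"
      using trace_matpow_young[OF hermitian_X, of y] y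
      by (intro integral_mono integrable_mult_right Bochner_Integration.integrable_add integrable_trace_pow integrable_const)
        (auto simp: pow_def)
    then show ?thesis
      unfolding moment_def by (simp add: integrable_trace_pow prob_space del: mult_Suc_right power_Suc)
  qed
  assume "\<not> ?thesis"
  then have gt: "m6 > D" by (simp add: m6_def D_def)
  have m2: "m2 \<ge> 0" by (simp add: m2_def moment_nonneg)
  have \<alpha>: "\<alpha> \<ge> 0" by (simp add: \<alpha>_def spectral_norm_nonneg)
  have 1: "real (q + 3) * (y * m4) \<le> real (q + 2) * m6 + D"
    using young[of "q + 2"] by (simp add: m4_def m6_def D_def algebra_simps eval_nat_numeral)
  also have "\<dots> < real (q + 3) * m6" using gt by (simp add: algebra_simps)
  finally have t: "y * m4 < m6" by (simp add: mult_less_cancel_left_pos)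
  have "real (q + 2) * (y * m2) \<le> real (q + 1) * m4 + real CARD('d) * y ^ (q + 2)"
    using young[of "q + 1"] by (simp add: m4_def m2_def D_def algebra_simps eval_nat_numeral)
  then have "y * (real (q + 2) * (y * m2)) \<le> y * (real (q + 1) * m4 + real CARD('d) * y ^ (q + 2))"
    using y by (intro mult_left_mono) auto
  then have "real (q + 2) * (y\<^sup>2 * m2) \<le> real (q + 1) * (y * m4) + D"
    by (simp add: D_def algebra_simps power2_eq_square eval_nat_numeral)
  also have "\<dots> < real (q + 1) * m6 + m6"
    using t gt by (intro add_le_less_mono mult_left_mono) auto
  also have "\<dots> = real (q + 2) * m6" by (simp add: algebra_simps)
  finally have t2: "y\<^sup>2 * m2 < m6" by (simp add: mult_less_cancel_left_pos)
  have \<beta>: "real (2 * q + 1) * ((spectral_norm V)\<^sup>2 + real (2 * q + 2) * matrix_w n H ^ 4) \<le> \<beta>"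
    using rec by (simp add: \<beta>_def \<alpha>_def)
  have \<beta>0: "\<beta> \<ge> 0"
    by (rule order_trans[OF _ \<beta>]) (simp add: matrix_w_nonneg)
  have "m6 \<le> \<alpha> * m4 + \<beta> * m2"
    using moment_second_order[of q] mult_right_mono[OF \<beta> m2] by (simp add: m6_def m4_def m2_def \<alpha>_def)
  then have "y\<^sup>2 * m6 \<le> y\<^sup>2 * (\<alpha> * m4 + \<beta> * m2)" by (intro mult_left_mono) auto
  also have "\<dots> = \<alpha> * y * (y * m4) + \<beta> * (y\<^sup>2 * m2)" by (simp add: algebra_simps power2_eq_square)
  \<comment> \<open>Either coefficient may vanish, but not both, as
    \<open>\<alpha> * y + \<beta> = y\<^sup>2 > 0\<close>; hence the inequality stays
    strict.\<close>
  also have "\<dots> < \<alpha> * y * m6 + \<beta> * m6"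
  proof (cases "\<beta> = 0")
    case True
    then have "\<alpha> * y = y\<^sup>2" by (simp add: \<beta>_def)
    then have "\<alpha> * y > 0" using y by simp
    then show ?thesis using mult_strict_left_mono[OF t \<open>\<alpha> * y > 0\<close>] True by simp
  next
    case False
    then have "\<beta> * (y\<^sup>2 * m2) < \<beta> * m6" using \<beta>0 t2 by simp
    moreover have "\<alpha> * y * (y * m4) \<le> \<alpha> * y * m6" using \<alpha> y t by (intro mult_left_mono) auto
    ultimately show ?thesis by simp
  qed
  also have "\<dots> = y\<^sup>2 * m6" by (simp add: \<beta>_def algebra_simps)
  finally show False by simp
qed

lemma integrable_spectral_norm: "integrable M (\<lambda>\<omega>. spectral_norm (gauss_series n H \<gamma> \<omega>))"
proof (rule Bochner_Integration.integrable_bound)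
  show "integrable M (\<lambda>\<omega>. 1 + Re (trace (pow 2 \<omega>)))"
    by (intro Bochner_Integration.integrable_add integrable_trace_pow integrable_const)
  have "gauss_series n H \<gamma> \<in> borel_measurable M"
    using stein_derivation_integrable(1)[OF stein_derivation_gauss_series[of H]] by auto
  moreover have "(spectral_norm :: complex^'d^'d \<Rightarrow> real) \<in> borel_measurable borel"
    using continuous_on_spectral_norm[OF continuous_on_id] by (rule borel_measurable_continuous_onI)
  ultimately show "(\<lambda>\<omega>. spectral_norm (gauss_series n H \<gamma> \<omega>)) \<in> borel_measurable M"
    by (rule measurable_compose)
  have "norm (spectral_norm (gauss_series n H \<gamma> \<omega>)) \<le> norm (1 + Re (trace (pow 2 \<omega>)))" for \<omega>
  proof -
    define t where "t = spectral_norm (gauss_series n H \<gamma> \<omega>)"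
    have "0 \<le> t" by (simp add: t_def spectral_norm_nonneg)
    moreover have "t\<^sup>2 \<le> Re (trace (pow 2 \<omega>))"
      unfolding t_def pow_def by (rule spectral_norm_power_le_trace[OF hermitian_X]) simp
    moreover have "t \<le> 1 + t\<^sup>2"
      using zero_le_power2[of "t - 1"] \<open>0 \<le> t\<close> by (simp add: power2_diff)
    ultimately show ?thesis by (simp add: t_def)
  qed
  then show "AE \<omega> in M. norm (spectral_norm (gauss_series n H \<gamma> \<omega>)) \<le> norm (1 + Re (trace (pow 2 \<omega>)))"
    by simp
qed

text \<open>Jensen's inequality in tangent form: \<open>weighted_am_gm_Suc\<close> bounds the norm
  by an affine function of its N-th power, with contact at \<open>s\<close>.\<close>

lemma expectation_spectral_norm_le:
  assumes s: "0 < s" and N: "even N" "0 < N" and le: "moment N \<le> s ^ N"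
  shows "expectation (\<lambda>\<omega>. spectral_norm (gauss_series n H \<gamma> \<omega>)) \<le> s"
proof -
  obtain q where q: "N = Suc q" using N(2) gr0_implies_Suc by blast
  have "real N * s ^ q * spectral_norm (gauss_series n H \<gamma> \<omega>) \<le> real q * s ^ N + Re (trace (pow N \<omega>))" for \<omega>
    using weighted_am_gm_Suc[of s "spectral_norm (gauss_series n H \<gamma> \<omega>)" q]
      spectral_norm_power_le_trace[OF hermitian_X N(1), of \<omega>] s spectral_norm_nonneg
    unfolding q pow_def by (smt (verit, best))
  then have "expectation (\<lambda>\<omega>. real N * s ^ q * spectral_norm (gauss_series n H \<gamma> \<omega>))
      \<le> expectation (\<lambda>\<omega>. real q * s ^ N + Re (trace (pow N \<omega>)))"
    by (intro integral_mono integrable_mult_right Bochner_Integration.integrable_add integrable_trace_pow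
        integrable_const integrable_spectral_norm)
  then have "real N * s ^ q * expectation (\<lambda>\<omega>. spectral_norm (gauss_series n H \<gamma> \<omega>)) \<le> real q * s ^ N + moment N"
    unfolding moment_def by (simp add: integrable_trace_pow prob_space)
  also have "\<dots> \<le> real N * s ^ q * s" using le by (simp add: q algebra_simps)
  finally show ?thesis using s N by (simp add: mult_le_cancel_left_pos)
qed

end

section \<open>Numerical verification of the condition on \<open>y\<close>\<close>

lemma second_order_numeric:
  fixes L \<sigma> w s :: real
  assumes L: "2 < L" and \<sigma>: "0 \<le> \<sigma>" and w: "0 \<le> w" and q: "real (2 * q + 1) \<le> 2 * L - 3"
    and s: "3 * \<sigma> * root 4 (2 * exp 1 * L) + w * sqrt (2 * exp 1 * L) \<le> s"
  defines "y \<equiv> s\<^sup>2 / exp 1"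
  shows "4 * \<sigma>\<^sup>2 * y + real (2 * q + 1) * ((\<sigma>\<^sup>2)\<^sup>2 + real (2 * q + 2) * w ^ 4) \<le> y\<^sup>2"
proof -
  define c where "c = root 4 (2 * exp 1 * L)"
  have c0: "0 \<le> c" using L by (simp add: c_def)
  have c4: "c ^ 4 = 2 * exp 1 * L" using L by (simp add: c_def)
  have c2: "sqrt (2 * exp 1 * L) = c\<^sup>2"
    using c4 by (metis power2_eq_square power4_eq_xxxx mult.assoc real_sqrt_unique zero_le_power2)
  define \<rho> where "\<rho> = sqrt (real (2 * q + 1))"
  have \<rho>: "0 \<le> \<rho>" "\<rho>\<^sup>2 = real (2 * q + 1)" by (auto simp: \<rho>_def)
  have e: "0 < exp (1::real)" "exp (1::real) \<le> 3" using exp_le by auto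
  \<comment> \<open>The constant 3 of the theorem enters here, squared. As L > 2, the square of the
    left side is at most 26 + 4 L < 17 L, well below the 54 L that suffices.\<close>
  have "4 + \<rho> \<le> 9 * c\<^sup>2 / exp 1"
  proof (rule power2_le_imp_le)
    have "(4 + \<rho>)\<^sup>2 \<le> 2 * (16 + \<rho>\<^sup>2)"
      using zero_le_power2[of "4 - \<rho>"] by (simp add: power2_sum power2_diff)
    also have "\<dots> \<le> 54 * L" using q L \<rho> by simp
    also have "\<dots> \<le> 162 * L / exp 1" using e L by (simp add: field_simps)
    also have "\<dots> = 81 * c ^ 4 / (exp 1)\<^sup>2" unfolding c4 using e by (simp add: power2_eq_square)
    also have "\<dots> = (9 * c\<^sup>2 / exp 1)\<^sup>2" by (simp add: power_divide power_mult_distrib flip: power_mult)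
    finally show "(4 + \<rho>)\<^sup>2 \<le> (9 * c\<^sup>2 / exp 1)\<^sup>2" .
    show "0 \<le> 9 * c\<^sup>2 / exp 1" using e by simp
  qed
  then have 1: "(4 + \<rho>) * \<sigma>\<^sup>2 \<le> 9 * c\<^sup>2 / exp 1 * \<sigma>\<^sup>2" by (intro mult_right_mono) auto
  have "real (2 * q + 2) \<le> 2 * L" using q by simp
  then have 2: "real (2 * q + 2) * w\<^sup>2 \<le> 2 * L * w\<^sup>2" by (intro mult_right_mono) auto
  \<comment> \<open>Dropping the cross term separates \<sigma> from w; after division by e the
    w-part is exactly 2 L w^2, since c^4 = 2 e L.\<close>
  have "(3 * \<sigma> * c)\<^sup>2 + (w * c\<^sup>2)\<^sup>2 \<le> (3 * \<sigma> * c + w * c\<^sup>2)\<^sup>2"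
    using \<sigma> w c0 by (simp add: power2_sum)
  also have "\<dots> \<le> s\<^sup>2"
    using s \<sigma> w c0 unfolding c2 c_def[symmetric] by (intro power_mono) auto
  finally have "((3 * \<sigma> * c)\<^sup>2 + (w * c\<^sup>2)\<^sup>2) / exp 1 \<le> y"
    unfolding y_def by (intro divide_right_mono) auto
  moreover have "((3 * \<sigma> * c)\<^sup>2 + (w * c\<^sup>2)\<^sup>2) / exp 1 = 9 * c\<^sup>2 / exp 1 * \<sigma>\<^sup>2 + 2 * L * w\<^sup>2"
    using c4 e by (simp add: power_mult_distrib add_divide_distrib flip: power_mult)
  ultimately have y: "4 * \<sigma>\<^sup>2 + (\<rho> * \<sigma>\<^sup>2 + real (2 * q + 2) * w\<^sup>2) \<le> y"
    using 1 2 by (simp add: algebra_simps)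
  \<comment> \<open>The goal reads y (y - 4 \<sigma>^2) >= coefficient. Both factors are at least
    \<open>z\<close>, and z^2 dominates the sum of the squares of its two nonnegative parts.\<close>
  define z where "z = \<rho> * \<sigma>\<^sup>2 + real (2 * q + 2) * w\<^sup>2"
  have z: "0 \<le> z" using \<rho> by (simp add: z_def)
  have "real (2 * q + 1) * ((\<sigma>\<^sup>2)\<^sup>2 + real (2 * q + 2) * w ^ 4) \<le> (\<rho> * \<sigma>\<^sup>2)\<^sup>2 + (real (2 * q + 2) * w\<^sup>2)\<^sup>2"
  proof -
    have "real (2 * q + 1) * (real (2 * q + 2) * w ^ 4) \<le> real (2 * q + 2) * (real (2 * q + 2) * w ^ 4)"
      by (intro mult_right_mono) auto
    moreover have "(real (2 * q + 2) * w\<^sup>2)\<^sup>2 = real (2 * q + 2) * (real (2 * q + 2) * w ^ 4)"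
      by (simp add: power2_eq_square power4_eq_xxxx mult_ac)
    moreover have "(\<rho> * \<sigma>\<^sup>2)\<^sup>2 = real (2 * q + 1) * (\<sigma>\<^sup>2)\<^sup>2"
      unfolding power_mult_distrib \<rho>(2) ..
    ultimately show ?thesis unfolding distrib_left by linarith
  qed
  also have "\<dots> \<le> z\<^sup>2" using \<rho> by (simp add: z_def power2_sum)
  also have "\<dots> \<le> y * (y - 4 * \<sigma>\<^sup>2)"
  proof -
    have "z \<le> y - 4 * \<sigma>\<^sup>2" using y by (simp add: z_def)
    moreover have "z \<le> y" using calculation zero_le_power2[of \<sigma>] by linarith
    ultimately show ?thesis unfolding power2_eq_square[of z] using z by (intro mult_mono) auto
  qed
  finally show ?thesis by (simp add: algebra_simps power2_eq_square)
qed

theorem corollary3p6: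
  fixes M :: "'a measure" and \<gamma> :: "nat \<Rightarrow> 'a \<Rightarrow> real"
    and n :: nat and H :: "nat \<Rightarrow> complex^'d^'d"
  assumes "prob_space M"
    and "CARD('d) \<ge> 8"
    and "\<And>i. i \<in> {1..n} \<Longrightarrow> hermitian_matrix (H i)"
    and "prob_space.indep_vars M (\<lambda>_. borel) \<gamma> {1..n}"
    and "\<And>i. i \<in> {1..n} \<Longrightarrow> distributed M lborel (\<gamma> i) std_normal_density"
  shows "integrable M (\<lambda>\<omega>. spectral_norm (gauss_series n H \<gamma> \<omega>)) \<and>
    prob_space.expectation M (\<lambda>\<omega>. spectral_norm (gauss_series n H \<gamma> \<omega>))
      \<le> 3 * matrix_sigma n H * root 4 (2 * exp 1 * ln (real CARD('d)))
        + matrix_w n H * sqrt (2 * exp 1 * ln (real CARD('d)))"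
proof -
  interpret prob_space M by fact
  interpret hermitian_gauss_series M \<gamma> n H
    by unfold_locales (use assms in auto)
  define L where "L = ln (real CARD('d))"
  \<comment> \<open>The dimension 8 exceeds 2.72^2 > e^2. This gives L > 2, hence p >= 3, so that q
    = p - 3 exists.\<close>
  have "exp (2::real) = (exp 1)\<^sup>2" by (simp add: exp_double[symmetric])
  also have "\<dots> \<le> (272 / 100)\<^sup>2" using e_less_272 by (intro power_mono) auto
  also have "\<dots> < real CARD('d)" using assms(2) by (simp add: power2_eq_square)
  finally have "ln (exp 2) < L" unfolding L_def using assms(2) by (subst ln_less_cancel_iff) auto
  then have L: "2 < L" by simp
  define p where "p = nat \<lceil>L\<rceil>"
  have p: "L \<le> real p" "real p < L + 1" using L by (auto simp: p_def) linarith+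
  then have "3 \<le> p" using L by linarith
  then obtain q where q: "p = q + 3" using le_Suc_ex by (metis add.commute)
  \<comment> \<open>Rounding up rather than down yields d^(1/p) <= e; p < L + 1 still leaves 2q + 1
    = 2p - 5 < 2 L - 3.\<close>
  have d: "real CARD('d) \<le> exp 1 ^ (q + 3)"
  proof -
    have "real CARD('d) = exp L" by (simp add: L_def)
    also have "\<dots> \<le> exp (real p)" using p by simp
    also have "\<dots> = exp 1 ^ (q + 3)" unfolding q by (metis exp_of_nat_mult mult.right_neutral)
    finally show ?thesis .
  qed
  have sig: "(matrix_sigma n H)\<^sup>2 = spectral_norm V"
    by (simp add: matrix_sigma_def V_def spectral_norm_nonneg)
  have sig0: "0 \<le> matrix_sigma n H" by (simp add: matrix_sigma_def spectral_norm_nonneg)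
  let ?R = "3 * matrix_sigma n H * root 4 (2 * exp 1 * L) + matrix_w n H * sqrt (2 * exp 1 * L)"
  have R: "0 \<le> ?R" using L sig0 matrix_w_nonneg[of n H] by simp
  \<comment> \<open>A strictly larger \<open>s\<close> is taken because the right side is 0 when all
    \<open>H i\<close> vanish, whereas the moment argument needs \<open>s > 0\<close>.\<close>
  have "expectation (\<lambda>\<omega>. spectral_norm (gauss_series n H \<gamma> \<omega>)) \<le> s" if s: "?R < s" for s
  proof (rule expectation_spectral_norm_le)
    show s0: "0 < s" using s R by linarith
    define y where "y = s\<^sup>2 / exp 1"
    have "moment (2 * q + 6) \<le> real CARD('d) * y ^ (q + 3)"
    proof (rule moment_le)
      show "0 < y" using s0 by (simp add: y_def)
      show "4 * spectral_norm V * y + real (2 * q + 1) * ((spectral_norm V)\<^sup>2 + real (2 * q + 2) * matrix_w n H ^ 4) \<le> y\<^sup>2"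
        unfolding sig[symmetric] y_def
        by (rule second_order_numeric[OF L sig0 matrix_w_nonneg]) (use p q s in auto)
    qed
    also have "\<dots> \<le> exp 1 ^ (q + 3) * y ^ (q + 3)"
      using d by (intro mult_right_mono) (auto simp: y_def)
    also have "\<dots> = (s\<^sup>2) ^ (q + 3)" by (simp add: y_def flip: power_mult_distrib)
    also have "\<dots> = s ^ (2 * q + 6)" by (simp add: algebra_simps flip: power_mult)
    finally show "moment (2 * q + 6) \<le> s ^ (2 * q + 6)" .
  qed auto
  then have "expectation (\<lambda>\<omega>. spectral_norm (gauss_series n H \<gamma> \<omega>)) \<le> ?R"
    by (rule dense_ge)
  then show ?thesis using integrable_spectral_norm by (simp add: L_def)
qed

end
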